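(* Let $h:\Delta_n\to\mathbb{Q}$ be a hive. Then there exists $F=\sum_{(i,j,k)\in\Delta_n}F_{ijk}(t)\,x^iy^jz^k$ with all $F_{ijk}\in\mathbb{R}\{t\}_+$ and $l(F_{ijk})=h_{ijk}$ for all $(i,j,k)\in\Delta_n$ such that $F\in\mathcal{H}_n(\mathbb{C}\{t\})$.
   Context: $\mathbb{C}\{t\}$ is the field of Puiseux series in $t^{-1}$, i.e. $\bigcup_{m\ge1}$ of the fields of Laurent series in $t^{-1/m}$ (finitely many positive powers of $t$) with complex coefficients that converge for all sufficiently large real $t$. $\mathbb{R}\{t\}\subset\mathbb{C}\{t\}$ is the subfield of series with real coefficients, and $\mathbb{R}\{t\}_+$ is the set of nonzero elements of $\mathbb{R}\{t\}$ whose leading term (the term with the largest exponent of $t$) has positive coefficient. $\mathbb{R}\{t\}$ is a real closed ordered field with positive elements $\mathbb{R}\{t\}_+$, and $\mathbb{C}\{t\}=\mathbb{R}\{t\}(\sqrt{-1})$ is its algebraic closure; "Hermitian" and "positive definite" for matrices over $\mathbb{C}\{t\}$ are defined as over $\mathbb{C}$, using this ordering. The map $l:\mathbb{C}\{t\}^*\to\mathbb{Q}$ sends a series to the exponent of its leading term. $\mathcal{H}_n(\mathbb{C}\{t\})$ is the set of homogeneous degree $n$ polynomials in $\mathbb{R}\{t\}[x,y,z]$ of the form $\det(xX+yY+zZ)$ with $X,Y,Z$ positive definite Hermitian $n\times n$ matrices with entries in $\mathbb{C}\{t\}$. $\Delta_n$ is the set of triples $(i,j,k)$ of nonnegative integers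 with $i+j+k=n$. A real-valued function $h$ on $\Delta_n$ is a hive if $$h_{(i+1)j(k-1)}+h_{i(j+1)(k-1)}\ge h_{ijk}+h_{(i+1)(j+1)(k-2)},$$ $$h_{(i+1)(j-1)k}+h_{i(j-1)(k+1)}\ge h_{ijk}+h_{(i+1)(j-2)(k+1)},$$ $$h_{(i-1)(j+1)k}+h_{(i-1)j(k+1)}\ge h_{ijk}+h_{(i-2)(j+1)(k+1)}$$ whenever all the indices occurring lie in $\Delta_n$. *)

theory Defs
  imports
    "HOL-Complex_Analysis.Complex_Analysis"
    "HOL-Library.Poly_Mapping"
    "Jordan_Normal_Form.Determinant"
begin

section \<open>The field of convergent complex Puiseux series at infinity\<close>

text \<open>
  A series is represented by its coefficient function \<^term>\<open>a :: rat \<Rightarrow> complex\<close>, where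
  \<^term>\<open>a q\<close> is the coefficient of \<open>t\<^sup>q\<close>.  The exponents that occur are of the form
  \<open>(N - k) / m\<close> for fixed \<open>m > 0\<close> and \<open>N\<close>, where \<open>k\<close> ranges over the natural numbers, i.e. the
  series is a Laurent series in \<open>t powr (- 1 / m)\<close>.
\<close>

definition convergent_puiseux :: "(rat \<Rightarrow> complex) \<Rightarrow> bool" where
  "convergent_puiseux a \<longleftrightarrow>
     (\<exists>m::nat. m > 0 \<and> (\<exists>N::int. let e = (\<lambda>k::nat. of_int (N - int k) / of_nat m) in
        {q. a q \<noteq> 0} \<subseteq> range e \<and>
        (\<forall>\<^sub>F t::real in at_top.
           summable (\<lambda>k. a (e k) * complex_of_real (t powr of_rat (e k))))))"

text \<open>
  The formal Laurent series \<open>F\<close> evaluated at \<open>t powr (- 1 / m)\<close>; an auxiliary notion used in proofs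
  only.
\<close>

definition puiseux_of_fls :: "nat \<Rightarrow> complex fls \<Rightarrow> rat \<Rightarrow> complex" where
  "puiseux_of_fls m F = (\<lambda>q. if of_nat m * q \<in> \<int> then fls_nth F (- \<lfloor>of_nat m * q\<rfloor>) else 0)"

lemma puiseux_of_fls_nth:
  assumes "m > 0"
  shows "puiseux_of_fls m F (of_int i / of_nat m) = fls_nth F (- i)"
  using assms by (simp add: puiseux_of_fls_def)

lemma puiseux_of_fls_nonzeroD:
  assumes "m > 0" "puiseux_of_fls m F q \<noteq> 0"
  obtains i where "q = of_int (- i) / of_nat m" "fls_nth F i \<noteq> 0"
proof -
  from assms have "of_nat m * q \<in> \<int>" and *: "fls_nth F (- \<lfloor>of_nat m * q\<rfloor>) \<noteq> 0"
    by (auto simp: puiseux_of_fls_def split: if_splits)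
  then obtain i where i: "of_nat m * q = of_int i"
    by (auto elim: Ints_cases)
  with assms have "q = of_int i / of_nat m"
    by (simp add: field_simps)
  with * i that[of "- i"] show ?thesis
    by simp
qed

lemma powr_neg_inverse_powi:
  assumes "t > 0" "m > 0"
  shows "(t powr (- 1 / real m)) powi i = t powr (- of_int i / real m)"
  using assms by (simp add: powr_real_of_int' [symmetric] powr_powr)

lemma convergent_puiseux_iff:
  "convergent_puiseux a \<longleftrightarrow> (\<exists>m>0. \<exists>F. fls_conv_radius F > 0 \<and> a = puiseux_of_fls m F)"
proof
  assume "convergent_puiseux a"
  then obtain m N where m: "m > 0"
    and supp: "{q. a q \<noteq> 0} \<subseteq> range (\<lambda>k::nat. of_int (N - int k) / of_nat m)"
    and conv: "\<forall>\<^sub>F t::real in at_top. summable (\<lambda>k. a (of_int (N - int k) / of_nat m) *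
                 complex_of_real (t powr of_rat (of_int (N - int k) / of_nat m)))"
    by (auto simp: convergent_puiseux_def Let_def)
  define A where "A = Abs_fps (\<lambda>k. a (of_int (N - int k) / of_nat m))"
  define F where "F = fls_shift N (fps_to_fls A)"
  from conv eventually_gt_at_top[of "0::real"] have "\<forall>\<^sub>F t::real in at_top. t > 0 \<and>
      summable (\<lambda>k. a (of_int (N - int k) / of_nat m) *
                 complex_of_real (t powr of_rat (of_int (N - int k) / of_nat m)))"
    by eventually_elim auto
  then obtain t :: real where t: "t > 0" and sm: "summable (\<lambda>k. a (of_int (N - int k) / of_nat m) *
                 complex_of_real (t powr of_rat (of_int (N - int k) / of_nat m)))"
    using eventually_happens'[OF trivial_limit_at_top_linorder] by blast
  define z where "z = t powr (- 1 / real m)"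
  have z: "z > 0" using t by (simp add: z_def)
  have "a (of_int (N - int k) / of_nat m) *
          complex_of_real (t powr of_rat (of_int (N - int k) / of_nat m))
        = complex_of_real (t powr (of_int N / real m)) * (fps_nth A k * complex_of_real z ^ k)" for k
  proof -
    have "t powr of_rat (of_int (N - int k) / of_nat m)
        = t powr (of_int N / real m + - of_int (int k) / real m)"
      by (simp add: of_rat_divide diff_divide_distrib of_rat_diff)
    also have "\<dots> = t powr (of_int N / real m) * z powi int k"
      by (simp only: powr_add z_def powr_neg_inverse_powi[OF t m])
    finally show ?thesis
      by (simp add: A_def)
  qed
  with sm have "summable (\<lambda>k. complex_of_real (t powr (of_int N / real m)) *
                  (fps_nth A k * complex_of_real z ^ k))"
    by simp
  hence "summable (\<lambda>k. fps_nth A k * complex_of_real z ^ k)"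
    using t by (subst (asm) summable_cmult_iff) auto
  hence "conv_radius (fps_nth A) \<ge> norm (complex_of_real z)"
    by (rule conv_radius_geI)
  with z have "fps_conv_radius A > 0"
    unfolding fps_conv_radius_def by (auto intro: less_le_trans[of _ "ereal z"])
  hence F: "fls_conv_radius F > 0"
    by (simp add: F_def)
  have "a q = puiseux_of_fls m F q" for q
  proof (cases "of_nat m * q \<in> \<int>")
    case True
    then obtain i where "of_nat m * q = of_int i"
      by (auto elim: Ints_cases)
    with m have q: "q = of_int i / of_nat m"
      by (simp add: field_simps)
    show ?thesis
    proof (cases "i \<le> N")
      case True
      thus ?thesis unfolding q puiseux_of_fls_nth[OF m]
        by (simp add: F_def A_def)
    next
      case False
      have "a q = 0"
      proof (rule ccontr)
        assume "a q \<noteq> 0"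
        then obtain k :: nat where "q = of_int (N - int k) / of_nat m"
          using supp by blast
        with q m have "rat_of_int i = rat_of_int (N - int k)"
          by (simp add: field_simps)
        hence "i = N - int k"
          by (simp only: of_int_eq_iff)
        with False show False by simp
      qed
      with False show ?thesis unfolding q puiseux_of_fls_nth[OF m]
        by (simp add: F_def A_def)
    qed
  next
    case False
    have "a q = 0"
    proof (rule ccontr)
      assume "a q \<noteq> 0"
      then obtain k :: nat where "q = of_int (N - int k) / of_nat m"
        using supp by blast
      with m have "of_nat m * q = of_int (N - int k)"
        by simp
      with False show False
        by (metis Ints_of_int)
    qed
    with False show ?thesis by (simp add: puiseux_of_fls_def)
  qed
  with m F show "\<exists>m>0. \<exists>F. fls_conv_radius F > 0 \<and> a = puiseux_of_fls m F"
    by blast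
next
  assume "\<exists>m>0. \<exists>F. fls_conv_radius F > 0 \<and> a = puiseux_of_fls m F"
  then obtain m F where m: "m > 0" and F: "fls_conv_radius F > 0" and a: "a = puiseux_of_fls m F"
    by blast
  define N where "N = - fls_subdegree F"
  define e where "e = (\<lambda>k::nat. rat_of_int (N - int k) / of_nat m)"
  have "{q. a q \<noteq> 0} \<subseteq> range e"
  proof
    fix q assume "q \<in> {q. a q \<noteq> 0}"
    hence "puiseux_of_fls m F q \<noteq> 0"
      by (simp add: a)
    with m obtain i where i: "q = of_int (- i) / of_nat m" "fls_nth F i \<noteq> 0"
      by (rule puiseux_of_fls_nonzeroD)
    from i(2) have "i \<ge> fls_subdegree F"
      using fls_subdegree_leI by blast
    hence "q = e (nat (i + N))"
      using i(1) by (simp add: e_def N_def)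
    thus "q \<in> range e" by blast
  qed
  moreover have "\<forall>\<^sub>F t::real in at_top.
                   summable (\<lambda>k. a (e k) * complex_of_real (t powr of_rat (e k)))"
  proof -
    have "((\<lambda>t. t powr (- 1 / real m)) \<longlongrightarrow> 0) at_top"
      using m by (intro tendsto_neg_powr filterlim_ident) auto
    hence lim: "((\<lambda>t. ereal (t powr (- 1 / real m))) \<longlongrightarrow> 0) at_top"
      by (simp add: zero_ereal_def)
    have "\<forall>\<^sub>F t::real in at_top. ereal (t powr (- 1 / real m)) < fls_conv_radius F"
      using order_tendstoD(2)[OF lim F] .
    with eventually_gt_at_top[of "0::real"] show ?thesis
    proof eventually_elim
      case (elim t)
      define z where "z = complex_of_real (t powr (- 1 / real m))"
      have "(\<lambda>k. fls_nth F (int k + fls_subdegree F) * z powi (int k + fls_subdegree F))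
              sums eval_fls F z"
        using elim by (intro sums_eval_fls) (auto simp: z_def)
      hence "summable (\<lambda>k. fls_nth F (int k - N) * z powi (int k - N))"
        by (auto simp: sums_iff N_def)
      also have "(\<lambda>k. fls_nth F (int k - N) * z powi (int k - N)) =
                 (\<lambda>k. a (e k) * complex_of_real (t powr of_rat (e k)))"
      proof
        fix k
        have "z powi (int k - N) = complex_of_real ((t powr (- 1 / real m)) powi (int k - N))"
          unfolding z_def by (simp only: of_real_power_int)
        also have "\<dots> = complex_of_real (t powr (- of_int (int k - N) / real m))"
          using elim m by (simp only: powr_neg_inverse_powi)
        also have "- of_int (int k - N) / real m = of_rat (e k)"
          by (simp add: e_def of_rat_divide of_rat_diff)
        finally show "fls_nth F (int k - N) * z powi (int k - N) =
                      a (e k) * complex_of_real (t powr of_rat (e k))"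
          unfolding a e_def puiseux_of_fls_nth[OF m] by simp
      qed
      finally show ?case .
    qed
  qed
  ultimately show "convergent_puiseux a"
    unfolding convergent_puiseux_def Let_def e_def using m by blast
qed

lemma fls_conv_radius_inverse_pos:
  assumes "fls_conv_radius F > 0"
  shows "fls_conv_radius (inverse F) > 0"
proof -
  have "eval_fls F has_laurent_expansion F"
    using assms by (simp add: has_laurent_expansion_def)
  from has_laurent_expansion_inverse[OF this] show ?thesis
    by (simp add: has_laurent_expansion_def)
qed

lemma fls_conv_radius_compose_power_pos:
  assumes "fls_conv_radius F > 0" "d > 0"
  shows "fls_conv_radius (fls_compose_power F d) > 0"
proof -
  from assms(1) obtain r :: real where r: "0 < r" "ereal r < fls_conv_radius F"
    using ereal_dense2[of 0 "fls_conv_radius F"] by (auto simp: zero_ereal_def)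
  define z where "z = complex_of_real (root d r)"
  have z: "z ^ d = complex_of_real r"
    using r assms(2) by (simp add: z_def flip: of_real_power)
  let ?f = "\<lambda>n. fps_nth (fls_regpart (fls_compose_power F d)) n * z ^ n"
  have "summable (\<lambda>n. fls_nth F (int n) * complex_of_real r ^ n)"
    using r by (intro summable_fls) auto
  also have "(\<lambda>n. fls_nth F (int n) * complex_of_real r ^ n) = (\<lambda>n. ?f (d * n))"
    using assms(2) by (auto simp: fun_eq_iff fls_nth_compose_power power_mult z)
  also have "summable \<dots> \<longleftrightarrow> summable ?f"
  proof (rule summable_mono_reindex)
    show "strict_mono (\<lambda>n. d * n)"
      using assms(2) by (auto simp: strict_mono_def)
    fix n assume "n \<notin> range (\<lambda>n. d * n)"
    hence "\<not> d dvd n" by auto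
    thus "?f n = 0" using assms(2) by (simp add: fls_nth_compose_power)
  qed
  finally have "conv_radius (fps_nth (fls_regpart (fls_compose_power F d))) \<ge> norm z"
    by (rule conv_radius_geI)
  moreover have "norm z > 0" using r assms(2) by (simp add: z_def)
  ultimately show ?thesis
    unfolding fls_conv_radius_def fps_conv_radius_def by (meson ereal_less(2) less_le_trans)
qed

lemma puiseux_of_fls_rescale:
  assumes "m > 0" "d > 0"
  shows "puiseux_of_fls m F = puiseux_of_fls (m * d) (fls_compose_power F d)"
proof
  fix q :: rat
  show "puiseux_of_fls m F q = puiseux_of_fls (m * d) (fls_compose_power F d) q"
  proof (cases "of_nat (m * d) * q \<in> \<int>")
    case True
    then obtain i where i: "of_nat (m * d) * q = of_int i"
      by (auto elim: Ints_cases)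
    show ?thesis
    proof (cases "int d dvd i")
      case True
      then obtain j where j: "i = int d * j" by auto
      with i assms have "of_nat m * q = of_int j"
        by (simp add: mult_ac)
      moreover have "- (int d * j) div int d = - j"
        using assms by (metis mult_minus_right nonzero_mult_div_cancel_left of_nat_0_less_iff less_irrefl)
      ultimately show ?thesis
        using i j assms unfolding puiseux_of_fls_def i floor_of_int by (simp add: fls_nth_compose_power)
    next
      case False
      have "of_nat m * q \<notin> \<int>"
      proof
        assume "of_nat m * q \<in> \<int>"
        then obtain j where j: "of_nat m * q = of_int j"
          by (rule Ints_cases)
        have "rat_of_int i = of_nat d * (of_nat m * q)"
          unfolding i[symmetric] by (simp add: mult_ac)
        also have "\<dots> = rat_of_int (int d * j)"
          unfolding j by simp
        finally have "rat_of_int i = rat_of_int (int d * j)" .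
        hence "i = int d * j"
          by (simp only: of_int_eq_iff)
        with False show False by simp
      qed
      with False assms show ?thesis
        unfolding puiseux_of_fls_def i by (simp add: fls_nth_compose_power)
    qed
  next
    case False
    have "of_nat m * q \<notin> \<int>"
    proof
      assume "of_nat m * q \<in> \<int>"
      hence "of_nat d * (of_nat m * q) \<in> \<int>"
        by (rule Ints_mult[OF Ints_of_nat])
      hence "of_nat (m * d) * q \<in> \<int>"
        by (simp only: of_nat_mult mult_ac)
      with False show False by contradiction
    qed
    with False show ?thesis
      by (simp add: puiseux_of_fls_def)
  qed
qed

lemma puiseux_of_fls_inject:
  assumes "m > 0"
  shows "puiseux_of_fls m F = puiseux_of_fls m G \<longleftrightarrow> F = G"
proof
  assume eq: "puiseux_of_fls m F = puiseux_of_fls m G"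
  show "F = G"
  proof (rule fls_eqI)
    fix i
    show "fls_nth F i = fls_nth G i"
      using puiseux_of_fls_nth[OF assms, of F "- i"] puiseux_of_fls_nth[OF assms, of G "- i"] eq
      by simp
  qed
qed simp

definition puiseux_conv :: "(rat \<Rightarrow> complex) \<Rightarrow> (rat \<Rightarrow> complex) \<Rightarrow> rat \<Rightarrow> complex" where
  "puiseux_conv a b = (\<lambda>q. \<Sum>p | a p \<noteq> 0 \<and> b (q - p) \<noteq> 0. a p * b (q - p))"

lemma puiseux_of_fls_add:
  "(\<lambda>q. puiseux_of_fls m F q + puiseux_of_fls m G q) = puiseux_of_fls m (F + G)"
  by (auto simp: puiseux_of_fls_def)

lemma puiseux_of_fls_diff:
  "(\<lambda>q. puiseux_of_fls m F q - puiseux_of_fls m G q) = puiseux_of_fls m (F - G)"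
  by (auto simp: puiseux_of_fls_def)

lemma puiseux_of_fls_uminus:
  "(\<lambda>q. - puiseux_of_fls m F q) = puiseux_of_fls m (- F)"
  by (auto simp: puiseux_of_fls_def)

lemma puiseux_of_fls_0: "puiseux_of_fls m 0 = (\<lambda>q. 0)"
  by (auto simp: puiseux_of_fls_def)

lemma puiseux_of_fls_1:
  assumes "m > 0"
  shows "puiseux_of_fls m 1 = (\<lambda>q. if q = 0 then 1 else 0)"
proof
  fix q :: rat
  show "puiseux_of_fls m 1 q = (if q = 0 then 1 else 0)"
  proof (cases "of_nat m * q \<in> \<int>")
    case True
    then obtain i where i: "of_nat m * q = of_int i"
      by (rule Ints_cases)
    have "q = 0 \<longleftrightarrow> of_nat m * q = 0"
      using assms by simp
    also have "\<dots> \<longleftrightarrow> i = 0"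
      unfolding i by simp
    finally show ?thesis
      unfolding puiseux_of_fls_def i floor_of_int by simp
  next
    case False
    hence "q \<noteq> 0" by auto
    with False show ?thesis by (simp add: puiseux_of_fls_def)
  qed
qed

lemma puiseux_of_fls_mult:
  assumes m: "m > 0"
  shows "puiseux_conv (puiseux_of_fls m F) (puiseux_of_fls m G) = puiseux_of_fls m (F * G)"
proof
  fix q :: rat
  let ?a = "puiseux_of_fls m F" and ?b = "puiseux_of_fls m G"
  let ?S = "{p. ?a p \<noteq> 0 \<and> ?b (q - p) \<noteq> 0}"
  show "puiseux_conv ?a ?b q = puiseux_of_fls m (F * G) q"
  proof (cases "of_nat m * q \<in> \<int>")
    case False
    have "?S = {}"
    proof (rule ccontr)
      assume "?S \<noteq> {}"
      then obtain p where "?a p \<noteq> 0" "?b (q - p) \<noteq> 0" by blast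
      hence "of_nat m * p \<in> \<int>" "of_nat m * (q - p) \<in> \<int>"
        by (auto simp: puiseux_of_fls_def split: if_splits)
      hence "of_nat m * p + of_nat m * (q - p) \<in> \<int>"
        by (rule Ints_add)
      with False show False by (simp add: algebra_simps)
    qed
    hence "puiseux_conv ?a ?b q = 0"
      unfolding puiseux_conv_def by (simp only: sum.empty)
    thus ?thesis using False by (simp add: puiseux_of_fls_def)
  next
    case True
    then obtain i where "of_nat m * q = of_int i"
      by (auto elim: Ints_cases)
    then obtain n where "of_nat m * q = of_int (- n)"
      by (metis minus_minus)
    with m have q: "q = of_int (- n) / of_nat m"
      by (simp add: field_simps)
    define g where "g = (\<lambda>i. rat_of_int (- i) / of_nat m)"
    define I where "I = {fls_subdegree F..n - fls_subdegree G}"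
    have ag: "?a (g i) = fls_nth F i" for i
      unfolding g_def puiseux_of_fls_nth[OF m] by simp
    have bg: "?b (q - g i) = fls_nth G (n - i)" for i
    proof -
      have "q - g i = of_int (i - n) / of_nat m"
        by (simp add: q g_def diff_divide_distrib)
      thus ?thesis by (simp only: puiseux_of_fls_nth[OF m]) simp
    qed
    have sub: "?S \<subseteq> g ` I"
    proof
      fix p assume p: "p \<in> ?S"
      hence "?a p \<noteq> 0" by simp
      with m obtain i where i: "p = g i" "fls_nth F i \<noteq> 0"
        unfolding g_def by (rule puiseux_of_fls_nonzeroD)
      from p i(1) bg have "fls_nth G (n - i) \<noteq> 0" by auto
      with i(2) have "i \<ge> fls_subdegree F" "n - i \<ge> fls_subdegree G"
        using fls_subdegree_leI by blast+
      with i(1) show "p \<in> g ` I" by (auto simp: I_def)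
    qed
    have inj: "inj_on g I"
      using m by (auto simp: inj_on_def g_def)
    have "puiseux_conv ?a ?b q = (\<Sum>p\<in>g ` I. ?a p * ?b (q - p))"
      unfolding puiseux_conv_def using sub by (intro sum.mono_neutral_left) (auto simp: I_def)
    also have "\<dots> = (\<Sum>i\<in>I. fls_nth F i * fls_nth G (n - i))"
      by (subst sum.reindex[OF inj]) (simp add: ag bg)
    also have "\<dots> = fls_nth (F * G) n"
      unfolding I_def by (rule fls_times_nth(2)[symmetric])
    also have "\<dots> = puiseux_of_fls m (F * G) q"
      unfolding q puiseux_of_fls_nth[OF m] by simp
    finally show ?thesis .
  qed
qed

lemma convergent_puiseux_common:
  assumes "convergent_puiseux a" "convergent_puiseux b" "convergent_puiseux c"
  obtains m F G H where "m > 0"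
    "fls_conv_radius F > 0" "fls_conv_radius G > 0" "fls_conv_radius H > 0"
    "a = puiseux_of_fls m F" "b = puiseux_of_fls m G" "c = puiseux_of_fls m H"
proof -
  from assms obtain k l m F G H where *: "k > 0" "l > 0" "m > 0"
      "fls_conv_radius F > 0" "fls_conv_radius G > 0" "fls_conv_radius H > 0"
      "a = puiseux_of_fls k F" "b = puiseux_of_fls l G" "c = puiseux_of_fls m H"
    by (auto simp: convergent_puiseux_iff)
  show thesis
  proof (rule that)
    show "a = puiseux_of_fls (k * l * m) (fls_compose_power F (l * m))"
      using *(1-3) puiseux_of_fls_rescale[of k "l * m" F] by (simp only: *(7) mult_ac nat_0_less_mult_iff)
    show "b = puiseux_of_fls (k * l * m) (fls_compose_power G (k * m))"
      using *(1-3) puiseux_of_fls_rescale[of l "k * m" G] by (simp only: *(8) mult_ac nat_0_less_mult_iff)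
    show "c = puiseux_of_fls (k * l * m) (fls_compose_power H (k * l))"
      using *(1-3) puiseux_of_fls_rescale[of m "k * l" H] by (simp only: *(9) mult_ac nat_0_less_mult_iff)
  qed (use * in \<open>auto intro!: fls_conv_radius_compose_power_pos\<close>)
qed

lemma convergent_puiseuxI:
  "m > 0 \<Longrightarrow> fls_conv_radius F > 0 \<Longrightarrow> convergent_puiseux (puiseux_of_fls m F)"
  by (auto simp: convergent_puiseux_iff)

lemma convergent_puiseux_0: "convergent_puiseux (\<lambda>q. 0)"
  using convergent_puiseuxI[of 1 0] by (simp add: puiseux_of_fls_0)

lemma convergent_puiseux_1: "convergent_puiseux (\<lambda>q. if q = 0 then 1 else 0)"
  using convergent_puiseuxI[of 1 1] by (simp add: puiseux_of_fls_1)

lemma convergent_puiseux_add: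
  assumes "convergent_puiseux a" "convergent_puiseux b"
  shows "convergent_puiseux (\<lambda>q. a q + b q)"
  using assms convergent_puiseux_0
  by (rule convergent_puiseux_common)
     (auto simp: puiseux_of_fls_add intro!: convergent_puiseuxI less_le_trans[OF _ fls_conv_radius_add])

lemma convergent_puiseux_diff:
  assumes "convergent_puiseux a" "convergent_puiseux b"
  shows "convergent_puiseux (\<lambda>q. a q - b q)"
  using assms convergent_puiseux_0
  by (rule convergent_puiseux_common)
     (auto simp: puiseux_of_fls_diff intro!: convergent_puiseuxI less_le_trans[OF _ fls_conv_radius_diff])

lemma convergent_puiseux_uminus:
  assumes "convergent_puiseux a"
  shows "convergent_puiseux (\<lambda>q. - a q)"
  using convergent_puiseux_diff[OF convergent_puiseux_0 assms] by simp

lemma convergent_puiseux_mult: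
  assumes "convergent_puiseux a" "convergent_puiseux b"
  shows "convergent_puiseux (puiseux_conv a b)"
  using assms convergent_puiseux_0
  by (rule convergent_puiseux_common)
     (auto simp: puiseux_of_fls_mult intro!: convergent_puiseuxI less_le_trans[OF _ fls_conv_radius_mult])

lemma convergent_puiseux_cnj:
  assumes "convergent_puiseux a"
  shows "convergent_puiseux (\<lambda>q. cnj (a q))"
proof -
  have *: "summable (\<lambda>k. cnj (f k) * complex_of_real (g k))"
    if "summable (\<lambda>k. f k * complex_of_real (g k))" for f g
  proof -
    from that obtain s where "(\<lambda>k. f k * complex_of_real (g k)) sums s"
      by (auto simp: summable_def)
    hence "(\<lambda>k. cnj (f k * complex_of_real (g k))) sums cnj s"
      by (subst sums_cnj)
    thus ?thesis by (auto simp: sums_iff)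
  qed
  from assms obtain m N where mN: "m > 0"
      "{q. a q \<noteq> 0} \<subseteq> range (\<lambda>k::nat. of_int (N - int k) / of_nat m)"
      "\<forall>\<^sub>F t::real in at_top. summable (\<lambda>k. a (of_int (N - int k) / of_nat m) *
         complex_of_real (t powr of_rat (of_int (N - int k) / of_nat m)))"
    by (auto simp: convergent_puiseux_def Let_def)
  show ?thesis
    unfolding convergent_puiseux_def Let_def complex_cnj_zero_iff
    by (intro exI[of _ m] exI[of _ N] conjI mN(1,2) eventually_mono[OF mN(3)]) (rule *)
qed

typedef puiseux = "{a. convergent_puiseux a}" morphisms pcoeff Abs_puiseux
  using convergent_puiseux_0 by blast

setup_lifting type_definition_puiseux

lemma puiseux_eqI: "(\<And>q. pcoeff a q = pcoeff b q) \<Longrightarrow> a = b"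
  by (simp add: fun_eq_iff flip: pcoeff_inject)

lemma puiseux_common:
  obtains m F G H where "m > 0"
    "pcoeff a = puiseux_of_fls m F" "pcoeff b = puiseux_of_fls m G" "pcoeff c = puiseux_of_fls m H"
    "fls_conv_radius F > 0"
proof -
  have conv: "convergent_puiseux (pcoeff x)" for x
    using pcoeff[of x] by simp
  show thesis
    by (rule convergent_puiseux_common[OF conv[of a] conv[of b] conv[of c]]) (rule that)
qed

instantiation puiseux :: comm_ring_1
begin

lift_definition zero_puiseux :: puiseux is "\<lambda>q. 0"
  by (rule convergent_puiseux_0)

lift_definition one_puiseux :: puiseux is "\<lambda>q. if q = 0 then 1 else 0"
  by (rule convergent_puiseux_1)

lift_definition plus_puiseux :: "puiseux \<Rightarrow> puiseux \<Rightarrow> puiseux" is "\<lambda>a b q. a q + b q"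
  by (rule convergent_puiseux_add)

lift_definition minus_puiseux :: "puiseux \<Rightarrow> puiseux \<Rightarrow> puiseux" is "\<lambda>a b q. a q - b q"
  by (rule convergent_puiseux_diff)

lift_definition uminus_puiseux :: "puiseux \<Rightarrow> puiseux" is "\<lambda>a q. - a q"
  by (rule convergent_puiseux_uminus)

lift_definition times_puiseux :: "puiseux \<Rightarrow> puiseux \<Rightarrow> puiseux" is puiseux_conv
  by (rule convergent_puiseux_mult)

instance
proof
  fix a b c :: puiseux
  obtain m F G H where *: "m > 0"
    "pcoeff a = puiseux_of_fls m F" "pcoeff b = puiseux_of_fls m G" "pcoeff c = puiseux_of_fls m H"
    by (rule puiseux_common)
  note rews = times_puiseux.rep_eq plus_puiseux.rep_eq one_puiseux.rep_eq *(2-)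
    puiseux_of_fls_1[OF *(1), symmetric] puiseux_of_fls_mult[OF *(1)] puiseux_of_fls_add
  have "pcoeff (a * b * c) = pcoeff (a * (b * c))"
    by (simp only: rews mult.assoc)
  thus "a * b * c = a * (b * c)" by (simp only: pcoeff_inject)
  have "pcoeff (a * b) = pcoeff (b * a)"
    by (simp only: rews mult.commute)
  thus "a * b = b * a" by (simp only: pcoeff_inject)
  have "pcoeff (1 * a) = pcoeff a"
    by (simp only: rews mult_1_left)
  thus "1 * a = a" by (simp only: pcoeff_inject)
  have "pcoeff ((a + b) * c) = pcoeff (a * c + b * c)"
    by (simp only: rews distrib_right)
  thus "(a + b) * c = a * c + b * c" by (simp only: pcoeff_inject)
next
  show "(0::puiseux) \<noteq> 1"
    by transfer (auto simp: fun_eq_iff)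
qed (transfer; simp add: fun_eq_iff add_ac)+

end

lemma puiseux_inverse_ex:
  fixes a :: puiseux
  assumes "a \<noteq> 0"
  shows "\<exists>b. a * b = 1"
proof -
  obtain m F where *: "m > 0" "pcoeff a = puiseux_of_fls m F" "fls_conv_radius F > 0"
    by (rule puiseux_common[of a a a])
  have "F \<noteq> 0"
    using assms * by (auto simp: puiseux_of_fls_0 intro!: puiseux_eqI simp: zero_puiseux.rep_eq)
  define b where "b = Abs_puiseux (puiseux_of_fls m (inverse F))"
  have b: "pcoeff b = puiseux_of_fls m (inverse F)"
    unfolding b_def using *
    by (intro Abs_puiseux_inverse CollectI convergent_puiseuxI fls_conv_radius_inverse_pos)
  have "pcoeff (a * b) = pcoeff 1"
    using \<open>F \<noteq> 0\<close> unfolding times_puiseux.rep_eq one_puiseux.rep_eq b *(2) puiseux_of_fls_mult[OF *(1)]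
    by (simp add: puiseux_of_fls_1[OF *(1)])
  thus ?thesis by (auto simp: pcoeff_inject)
qed

instantiation puiseux :: field
begin

definition inverse_puiseux :: "puiseux \<Rightarrow> puiseux" where
  "inverse_puiseux a = (if a = 0 then 0 else SOME b. a * b = 1)"

definition divide_puiseux :: "puiseux \<Rightarrow> puiseux \<Rightarrow> puiseux" where
  "divide_puiseux a b = a * inverse b"

instance
proof
  fix a b :: puiseux
  show "inverse a * a = 1" if "a \<noteq> 0"
    using someI_ex[OF puiseux_inverse_ex[OF that]] that
    by (simp add: inverse_puiseux_def mult.commute)
qed (simp_all add: inverse_puiseux_def divide_puiseux_def)

end

instantiation puiseux :: conjugatable_field
begin

lift_definition conjugate_puiseux :: "puiseux \<Rightarrow> puiseux" is "\<lambda>a q. cnj (a q)"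
  by (rule convergent_puiseux_cnj)

instance
proof
  fix a b :: puiseux
  show "conjugate (conjugate a) = a"
    by transfer simp
  show "conjugate a = conjugate b \<longleftrightarrow> a = b"
    by transfer (simp add: fun_eq_iff)
  show "conjugate (a * b) = conjugate a * conjugate b"
    by transfer (simp add: puiseux_conv_def)
qed (transfer; simp add: fun_eq_iff)+

end


section \<open>Real series, leading exponents and positivity\<close>

definition real_puiseux :: "puiseux set" where
  "real_puiseux = {a. \<forall>q. pcoeff a q \<in> \<real>}"

text \<open>The exponent of the leading term; only meaningful for nonzero series.\<close>

definition lead_exp :: "puiseux \<Rightarrow> rat" where
  "lead_exp a = (GREATEST q. pcoeff a q \<noteq> 0)"

lemma
  assumes "a \<noteq> 0"
  shows pcoeff_lead_exp: "pcoeff a (lead_exp a) \<noteq> 0"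
    and lead_exp_greatest: "pcoeff a q \<noteq> 0 \<Longrightarrow> q \<le> lead_exp a"
proof -
  obtain m F where *: "m > 0" "pcoeff a = puiseux_of_fls m F"
    by (rule puiseux_common[of a a a])
  have "F \<noteq> 0"
    using assms * by (auto simp: puiseux_of_fls_0 intro!: puiseux_eqI simp: zero_puiseux.rep_eq)
  define d where "d = rat_of_int (- fls_subdegree F) / of_nat m"
  have d: "pcoeff a d \<noteq> 0"
    unfolding *(2) d_def puiseux_of_fls_nth[OF *(1)] using \<open>F \<noteq> 0\<close> by simp
  have le: "q \<le> d" if "pcoeff a q \<noteq> 0" for q
  proof -
    from that have "puiseux_of_fls m F q \<noteq> 0"
      by (simp add: *(2))
    with *(1) obtain i where i: "q = of_int (- i) / of_nat m" "fls_nth F i \<noteq> 0"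
      by (rule puiseux_of_fls_nonzeroD)
    from i(2) have "i \<ge> fls_subdegree F"
      using fls_subdegree_leI by blast
    thus ?thesis unfolding i(1) d_def by (intro divide_right_mono) auto
  qed
  have eq: "lead_exp a = d"
    unfolding lead_exp_def using d le by (rule Greatest_equality)
  show "pcoeff a (lead_exp a) \<noteq> 0"
    unfolding eq by (rule d)
  show "pcoeff a q \<noteq> 0 \<Longrightarrow> q \<le> lead_exp a"
    unfolding eq by (rule le)
qed

definition pos_puiseux :: "puiseux set" where
  "pos_puiseux = {a \<in> real_puiseux. a \<noteq> 0 \<and> Re (pcoeff a (lead_exp a)) > 0}"


section \<open>Determinants of positive definite Hermitian pencils\<close>

definition hermitian :: "nat \<Rightarrow> puiseux mat \<Rightarrow> bool" where
  "hermitian n X \<longleftrightarrow> X \<in> carrier_mat n n \<and> (\<forall>i<n. \<forall>j<n. X $$ (i, j) = conjugate (X $$ (j, i)))"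

text \<open>Positivity refers to the ordering whose positive elements are \<^const>\<open>pos_puiseux\<close>.\<close>

definition pos_def_hermitian :: "nat \<Rightarrow> puiseux mat \<Rightarrow> bool" where
  "pos_def_hermitian n X \<longleftrightarrow>
     hermitian n X \<and> (\<forall>v \<in> carrier_vec n. v \<noteq> 0\<^sub>v n \<longrightarrow> (X *\<^sub>v v) \<bullet>c v \<in> pos_puiseux)"

text \<open>
  Polynomials in \<open>x, y, z\<close>: the exponent triple \<open>(i, j, k)\<close> stands for the monomial
  \<open>x\<^sup>i y\<^sup>j z\<^sup>k\<close>, so that \<^term>\<open>Poly_Mapping.single (i, j, k) c\<close> is \<open>c x\<^sup>i y\<^sup>j z\<^sup>k\<close>.
\<close>

type_synonym triple = "nat \<times> nat \<times> nat"
type_synonym puiseux_poly3 = "triple \<Rightarrow>\<^sub>0 puiseux"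

definition Delta :: "nat \<Rightarrow> triple set" where
  "Delta n = {(i, j, k). i + j + k = n}"

lemma finite_Delta: "finite (Delta n)"
  by (rule finite_subset[of _ "{..n} \<times> {..n} \<times> {..n}"]) (auto simp: Delta_def)

definition pencil :: "puiseux mat \<Rightarrow> puiseux mat \<Rightarrow> puiseux mat \<Rightarrow> puiseux_poly3 mat" where
  "pencil X Y Z =
     map_mat (Poly_Mapping.single (1, 0, 0)) X +
     map_mat (Poly_Mapping.single (0, 1, 0)) Y +
     map_mat (Poly_Mapping.single (0, 0, 1)) Z"

definition \<H> :: "nat \<Rightarrow> puiseux_poly3 set" where
  "\<H> n = {F. Poly_Mapping.keys F \<subseteq> Delta n \<and> (\<forall>d. Poly_Mapping.lookup F d \<in> real_puiseux) \<and>
     (\<exists>X Y Z. pos_def_hermitian n X \<and> pos_def_hermitian n Y \<and> pos_def_hermitian n Z \<and>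
        F = Determinant.det (pencil X Y Z))}"


section \<open>Hives\<close>

text \<open>
  The guards \<open>k \<ge> 2\<close>, \<open>j \<ge> 2\<close>, \<open>i \<ge> 2\<close> say precisely that all indices occurring in the respective
  inequality are nonnegative, so the natural number subtractions are not truncated.
\<close>

definition hive :: "nat \<Rightarrow> (triple \<Rightarrow> 'a :: linordered_field) \<Rightarrow> bool" where
  "hive n h \<longleftrightarrow> (\<forall>(i, j, k) \<in> Delta n.
     (k \<ge> 2 \<longrightarrow> h (i+1, j, k-1) + h (i, j+1, k-1) \<ge> h (i, j, k) + h (i+1, j+1, k-2)) \<and>
     (j \<ge> 2 \<longrightarrow> h (i+1, j-1, k) + h (i, j-1, k+1) \<ge> h (i, j, k) + h (i+1, j-2, k+1)) \<and>
     (i \<ge> 2 \<longrightarrow> h (i-1, j+1, k) + h (i-1, j, k+1) \<ge> h (i, j, k) + h (i-2, j+1, k+1)))"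

end

theory Submission
  imports Defs
begin

text \<open>
  The idea is to look for \<open>X = P P\<^sup>T\<close>, \<open>Y = Q Q\<^sup>T\<close>, \<open>Z = R R\<^sup>T\<close> with invertible matrices \<open>P\<close>, \<open>Q\<close>, \<open>R\<close>
  of real series; such Gram matrices are positive definite.  By the Cauchy-Binet formula the
  coefficient of \<open>x\<^sup>i y\<^sup>j z\<^sup>k\<close> in \<open>det (x X + y Y + z Z)\<close> is the sum of the squares of all maximal minors
  of the \<open>n \<times> 3n\<close> matrix \<open>(P | Q | R)\<close> that use \<open>i\<close> columns of \<open>P\<close>, \<open>j\<close> of \<open>Q\<close> and \<open>k\<close> of \<open>R\<close>.  Squares of
  real series have positive leading coefficients, so nothing cancels, and the leading exponent of
  the coefficient is twice the largest leading exponent of such a minor.  The theorem becomes a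
  statement about exponents only: find \<open>P\<close>, \<open>Q\<close>, \<open>R\<close> for which this maximum is \<open>h (i, j, k) / 2\<close>.

  Take \<open>P\<close> to be a multiple of the identity and \<open>Q\<close> to be diagonal.  The minors in question are then indexed by
  partitions of the rows into sets \<open>I\<close>, \<open>J\<close>, \<open>S\<close> of sizes \<open>i\<close>, \<open>j\<close>, \<open>k\<close>, and they are minors of \<open>R\<close> on
  the rows \<open>S\<close>, up to a monomial that depends on \<open>J\<close>.  For \<open>R\<close> take the path matrix of a triangular planar network.
  It has vertices \<open>(r, c)\<close> with \<open>c \<le> r < n\<close>; a path enters row \<open>r\<close> at its
  left end, runs to the right and upwards (from row \<open>r\<close> to row \<open>r - 1\<close>) and leaves at a diagonal vertex \<open>(c, c)\<close>.
  Every vertex carries a power of \<open>t\<close> whose exponent is a second difference of \<open>h / 2\<close>.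

  A minor on the rows \<open>S\<close> has exponent at most the weight of the heaviest family of vertex-disjoint
  paths that start in \<open>S\<close>; \<open>best\<close> is this weight (\<open>net_minor_deg_le\<close>).  The three families of hive
  inequalities are what is needed for exchange inequalities (\<open>best_shifts\<close>) by which
  the partition with \<open>I\<close> before \<open>S\<close> before \<open>J\<close> is the best one of its type, with
  the expected total exponent (\<open>best_le_sorted\<close>, \<open>hive_telescope\<close>).  For this sorted partition
  the minor on the leftmost columns receives a contribution from one family of paths only, so it is a monomial of exactly that
  exponent (\<open>net_interval_minor\<close>), and the bound is attained.
\<close>

section \<open>Exponents and leading coefficients of Puiseux series\<close>

lemma pcoeff_0 [simp]: "pcoeff 0 q = 0"
  by (simp add: zero_puiseux.rep_eq)

lemma pcoeff_add: "pcoeff (a + b) q = pcoeff a q + pcoeff b q"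
  by (simp add: plus_puiseux.rep_eq)

lemma convergent_puiseux_monom: "convergent_puiseux (\<lambda>p. if p = q then 1 else 0)"
proof -
  obtain N d :: int where q: "q = of_int N / of_int d" "d > 0"
    using quotient_of_div quotient_of_denom_pos by (metis surj_pair)
  define m where "m = nat d"
  have m: "m > 0" "rat_of_int d = of_nat m" using q by (auto simp: m_def)
  have e0: "rat_of_int (N - int k) / of_nat m = q \<longleftrightarrow> k = 0" for k
    using m q by (auto simp: field_simps)
  show ?thesis
    unfolding convergent_puiseux_def Let_def
  proof (intro exI conjI)
    show "m > 0" by (fact m)
    show "{p. (if p = q then 1 else 0 :: complex) \<noteq> 0} \<subseteq> range (\<lambda>k. rat_of_int (N - int k) / of_nat m)"
      using e0[of 0] by auto
    show "\<forall>\<^sub>F t in at_top. summable (\<lambda>k. (if rat_of_int (N - int k) / of_nat m = q then 1 else 0) *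
        complex_of_real (t powr of_rat (rat_of_int (N - int k) / of_nat m)))"
      unfolding e0 by (intro always_eventually allI summable_finite[of "{0}"]) auto
  qed
qed

lift_definition tpow :: "rat \<Rightarrow> puiseux" is "\<lambda>q p. if p = q then 1 else 0"
  by (rule convergent_puiseux_monom)

lemma tpow_0: "tpow 0 = 1"
  by transfer simp

text \<open>
  The valuation bound \<open>l(a) \<le> q\<close>, made true for \<open>a = 0\<close> so that it is closed under sums.
\<close>

definition deg_le :: "puiseux \<Rightarrow> rat \<Rightarrow> bool" where
  "deg_le a q \<longleftrightarrow> (\<forall>p. pcoeff a p \<noteq> 0 \<longrightarrow> p \<le> q)"

lemma deg_le_0 [simp]: "deg_le 0 q"
  by (simp add: deg_le_def)

lemma deg_le_tpow [simp]: "deg_le (tpow q) q"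
  by (simp add: deg_le_def tpow.rep_eq)

lemma deg_le_mono: "deg_le a p \<Longrightarrow> p \<le> q \<Longrightarrow> deg_le a q"
  by (force simp: deg_le_def)

lemma deg_le_add: "deg_le a q \<Longrightarrow> deg_le b q \<Longrightarrow> deg_le (a + b) q"
  unfolding deg_le_def pcoeff_add by (metis add.right_neutral add.left_neutral)

lemma deg_le_sum: "(\<And>x. x \<in> A \<Longrightarrow> deg_le (f x) q) \<Longrightarrow> deg_le (sum f A) q"
  by (induction A rule: infinite_finite_induct) (auto intro: deg_le_add)

lemma pcoeff_mult:
  "pcoeff (a * b) q = (\<Sum>p | pcoeff a p \<noteq> 0 \<and> pcoeff b (q - p) \<noteq> 0. pcoeff a p * pcoeff b (q - p))"
  by (simp add: times_puiseux.rep_eq puiseux_conv_def)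

lemma deg_le_mult:
  assumes "deg_le a p" "deg_le b q"
  shows "deg_le (a * b) (p + q)"
  unfolding deg_le_def
proof (intro allI impI)
  fix s assume "pcoeff (a * b) s \<noteq> 0"
  then obtain r where "pcoeff a r \<noteq> 0" "pcoeff b (s - r) \<noteq> 0"
    unfolding pcoeff_mult by (metis (mono_tags, lifting) mem_Collect_eq sum.not_neutral_contains_not_neutral)
  with assms have "r \<le> p" "s - r \<le> q" by (auto simp: deg_le_def)
  then show "s \<le> p + q" by simp
qed

lemma pcoeff_mult_top:
  assumes "deg_le a p" "deg_le b q"
  shows "pcoeff (a * b) (p + q) = pcoeff a p * pcoeff b q"
proof -
  have "{r. pcoeff a r \<noteq> 0 \<and> pcoeff b (p + q - r) \<noteq> 0} \<subseteq> {p}"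
  proof
    fix r assume "r \<in> {r. pcoeff a r \<noteq> 0 \<and> pcoeff b (p + q - r) \<noteq> 0}"
    with assms have "r \<le> p" "p + q - r \<le> q" by (auto simp: deg_le_def)
    then show "r \<in> {p}" by simp
  qed
  then have "pcoeff (a * b) (p + q) = (\<Sum>r\<in>{p}. pcoeff a r * pcoeff b (p + q - r))"
    unfolding pcoeff_mult by (intro sum.mono_neutral_left) auto
  then show ?thesis by simp
qed

lemma tpow_mult: "tpow p * tpow q = tpow (p + q)"
proof (rule puiseux_eqI)
  fix s
  have "{r. pcoeff (tpow p) r \<noteq> 0 \<and> pcoeff (tpow q) (s - r) \<noteq> 0} = (if s = p + q then {p} else {})"
    by (auto simp: tpow.rep_eq)
  then show "pcoeff (tpow p * tpow q) s = pcoeff (tpow (p + q)) s"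
    unfolding pcoeff_mult by (simp add: tpow.rep_eq)
qed

lemma tpow_neq_0 [simp]: "tpow q \<noteq> 0"
  by (metis pcoeff_0 tpow.rep_eq zero_neq_one)

lemma tpow_sum: "finite A \<Longrightarrow> (\<Prod>x\<in>A. tpow (f x)) = tpow (sum f A)"
  by (induction A rule: finite_induct) (auto simp: tpow_0 tpow_mult)

lemma tpow_power: "tpow q ^ k = tpow (of_nat k * q)"
  by (induction k) (auto simp: tpow_0 tpow_mult algebra_simps)

lemma real_puiseux_iff: "a \<in> real_puiseux \<longleftrightarrow> conjugate a = a"
proof -
  have "a \<in> real_puiseux \<longleftrightarrow> (\<forall>q. pcoeff (conjugate a) q = pcoeff a q)"
    by (simp add: real_puiseux_def conjugate_puiseux.rep_eq Reals_cnj_iff)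
  also have "\<dots> \<longleftrightarrow> conjugate a = a" by (auto intro: puiseux_eqI)
  finally show ?thesis .
qed

lemma real_tpow [simp]: "tpow q \<in> real_puiseux"
  by (simp add: real_puiseux_def tpow.rep_eq)

lemma real_add: "a \<in> real_puiseux \<Longrightarrow> b \<in> real_puiseux \<Longrightarrow> a + b \<in> real_puiseux"
  by (simp add: real_puiseux_iff conjugate_dist_add)

lemma real_mult: "a \<in> real_puiseux \<Longrightarrow> b \<in> real_puiseux \<Longrightarrow> a * b \<in> real_puiseux"
  by (simp add: real_puiseux_iff conjugate_dist_mul)

lemma real_0 [simp]: "0 \<in> real_puiseux" and real_1 [simp]: "1 \<in> real_puiseux"
  by (auto simp: real_puiseux_def zero_puiseux.rep_eq one_puiseux.rep_eq)

lemma real_minus: "a \<in> real_puiseux \<Longrightarrow> - a \<in> real_puiseux"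
  by (simp add: real_puiseux_def uminus_puiseux.rep_eq)

lemma real_sum: "(\<And>x. x \<in> A \<Longrightarrow> f x \<in> real_puiseux) \<Longrightarrow> sum f A \<in> real_puiseux"
  by (induction A rule: infinite_finite_induct) (auto intro: real_add)

lemma real_prod: "(\<And>x. x \<in> A \<Longrightarrow> f x \<in> real_puiseux) \<Longrightarrow> prod f A \<in> real_puiseux"
  by (induction A rule: infinite_finite_induct) (auto intro: real_mult)

text \<open>
  Series whose exponents are at most \<open>q\<close> and whose coefficient at \<open>q\<close> may vanish but is not negative. Sums of
  such series cannot cancel at \<open>q\<close>, so one summand with a positive coefficient there fixes the
  leading term of the whole sum.
\<close>

definition nonneg_top :: "puiseux \<Rightarrow> rat \<Rightarrow> bool" where
  "nonneg_top a q \<longleftrightarrow> a \<in> real_puiseux \<and> deg_le a q \<and> Re (pcoeff a q) \<ge> 0"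

lemma nonneg_top_0 [simp]: "nonneg_top 0 q"
  by (simp add: nonneg_top_def)

lemma nonneg_top_add: "nonneg_top a q \<Longrightarrow> nonneg_top b q \<Longrightarrow> nonneg_top (a + b) q"
  by (auto simp: nonneg_top_def pcoeff_add intro: real_add deg_le_add)

lemma nonneg_top_sum: "(\<And>x. x \<in> A \<Longrightarrow> nonneg_top (f x) q) \<Longrightarrow> nonneg_top (sum f A) q"
  by (induction A rule: infinite_finite_induct) (auto intro: nonneg_top_add)

lemma Im_pcoeff_real: "a \<in> real_puiseux \<Longrightarrow> Im (pcoeff a q) = 0"
  by (auto simp: real_puiseux_def complex_is_Real_iff)

lemma nonneg_top_mult: "nonneg_top a p \<Longrightarrow> nonneg_top b q \<Longrightarrow> nonneg_top (a * b) (p + q)"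
  by (auto simp: nonneg_top_def pcoeff_mult_top Im_pcoeff_real intro: real_mult deg_le_mult)

lemma nonneg_top_square:
  assumes "a \<in> real_puiseux" "deg_le a q"
  shows "nonneg_top (a * a) (q + q)"
  using assms real_mult[of a a] deg_le_mult[of a q a q] pcoeff_mult_top[of a q a q]
  by (simp add: nonneg_top_def Im_pcoeff_real)

lemma nonneg_top_mono:
  assumes "nonneg_top a p" "p \<le> q"
  shows "nonneg_top a q"
proof (cases "p = q")
  case False
  with assms have "pcoeff a q = 0" by (force simp: nonneg_top_def deg_le_def)
  with assms show ?thesis by (auto simp: nonneg_top_def intro: deg_le_mono)
qed (use assms in simp)

lemma nonneg_top_tpow: "nonneg_top (tpow q) q"
  by (simp add: nonneg_top_def tpow.rep_eq)

lemma lead_exp_eqI: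
  assumes "pcoeff a q \<noteq> 0" "deg_le a q"
  shows "lead_exp a = q" and "a \<noteq> 0"
proof -
  show "a \<noteq> 0" using assms by auto
  with assms show "lead_exp a = q"
    using lead_exp_greatest[of a q] pcoeff_lead_exp[of a] by (force simp: deg_le_def)
qed

lemma pos_puiseuxI:
  assumes "a \<in> real_puiseux" "deg_le a q" "Re (pcoeff a q) > 0"
  shows "a \<in> pos_puiseux" "lead_exp a = q"
proof -
  have "pcoeff a q \<noteq> 0" using assms by auto
  from lead_exp_eqI[OF this assms(2)] assms
  show "a \<in> pos_puiseux" "lead_exp a = q" by (auto simp: pos_puiseux_def)
qed

lemma pos_puiseuxD:
  assumes "a \<in> pos_puiseux"
  shows "a \<in> real_puiseux" "deg_le a (lead_exp a)" "Re (pcoeff a (lead_exp a)) > 0"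
  using assms lead_exp_greatest[of a] by (auto simp: pos_puiseux_def deg_le_def)

lemma pos_puiseux_add:
  assumes "a \<in> pos_puiseux" "b \<in> pos_puiseux"
  shows "a + b \<in> pos_puiseux"
proof -
  have *: "a + b \<in> pos_puiseux" if ab: "a \<in> pos_puiseux" "b \<in> pos_puiseux" "lead_exp a \<le> lead_exp b" for a b
  proof (rule pos_puiseuxI)
    note a = pos_puiseuxD[OF ab(1)] and b = pos_puiseuxD[OF ab(2)]
    have "nonneg_top a (lead_exp a)" using a by (simp add: nonneg_top_def)
    from nonneg_top_mono[OF this ab(3)] have a': "deg_le a (lead_exp b)" "Re (pcoeff a (lead_exp b)) \<ge> 0"
      by (simp_all add: nonneg_top_def)
    show "a + b \<in> real_puiseux" by (rule real_add[OF a(1) b(1)])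
    show "deg_le (a + b) (lead_exp b)" by (rule deg_le_add[OF a'(1) b(2)])
    show "Re (pcoeff (a + b) (lead_exp b)) > 0" using a'(2) b(3) by (simp add: pcoeff_add)
  qed
  show ?thesis
  proof (cases "lead_exp a \<le> lead_exp b")
    case True
    then show ?thesis by (rule *[OF assms])
  next
    case False
    then have "lead_exp b \<le> lead_exp a" by simp
    from *[OF assms(2,1) this] show ?thesis by (simp add: add.commute)
  qed
qed

lemma pos_puiseux_norm:
  assumes "a \<noteq> 0"
  shows "a * conjugate a \<in> pos_puiseux"
proof (rule pos_puiseuxI)
  define q where "q = lead_exp a"
  have a: "deg_le a q" "pcoeff a q \<noteq> 0"
    using assms by (auto simp: deg_le_def q_def lead_exp_greatest pcoeff_lead_exp)
  then have ca: "deg_le (conjugate a) q" by (simp add: deg_le_def conjugate_puiseux.rep_eq)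
  show "a * conjugate a \<in> real_puiseux"
    by (simp add: real_puiseux_iff conjugate_dist_mul mult.commute)
  show "deg_le (a * conjugate a) (q + q)" by (intro deg_le_mult a ca)
  show "Re (pcoeff (a * conjugate a) (q + q)) > 0"
    unfolding pcoeff_mult_top[OF a(1) ca] using a(2)
    by (simp add: conjugate_puiseux.rep_eq complex_mult_cnj cmod_def sum_power2_gt_zero_iff complex_eq_iff)
qed

text \<open>
  This makes Gram matrices positive definite: each nonzero summand is \<open>|a|\<^sup>2\<close> with a positive
  leading coefficient, and the positive series are closed under addition.
\<close>

lemma pos_puiseux_norm_sum:
  assumes "finite A" "\<exists>x\<in>A. f x \<noteq> 0"
  shows "(\<Sum>x\<in>A. f x * conjugate (f x)) \<in> pos_puiseux"
proof -
  define B where "B = {x \<in> A. f x \<noteq> 0}"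
  have "finite B" "B \<noteq> {}" "\<And>x. x \<in> B \<Longrightarrow> f x \<noteq> 0" using assms by (auto simp: B_def)
  then have "(\<Sum>x\<in>B. f x * conjugate (f x)) \<in> pos_puiseux"
    by (induction B rule: finite_ne_induct) (simp_all add: pos_puiseux_norm pos_puiseux_add)
  also have "(\<Sum>x\<in>B. f x * conjugate (f x)) = (\<Sum>x\<in>A. f x * conjugate (f x))"
    using assms by (intro sum.mono_neutral_left) (auto simp: B_def)
  finally show ?thesis .
qed

instance puiseux :: field_char_0
proof
  have "pcoeff (of_nat k) 0 = of_nat k" for k
    by (induction k) (simp_all add: pcoeff_add one_puiseux.rep_eq)
  then show "inj (of_nat :: nat \<Rightarrow> puiseux)"
    by (metis injI of_nat_eq_iff)
qed

lemma pcoeff_of_nat_mult: "pcoeff (of_nat m * a) q = of_nat m * pcoeff a q"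
  by (induction m) (simp_all add: pcoeff_add algebra_simps)

lemma nonneg_top_div_nat:
  assumes "nonneg_top (of_nat m * a) q" "m > 0"
  shows "nonneg_top a q"
  using assms unfolding nonneg_top_def real_puiseux_def deg_le_def pcoeff_of_nat_mult
  by (auto simp: complex_is_Real_iff zero_le_mult_iff pcoeff_of_nat_mult)

section \<open>Determinants over finite index sets\<close>

text \<open>
  Leibniz' formula over an arbitrary finite index set instead of \<open>{0..<n}\<close>. With \<open>A a (f b)\<close> in place
  of \<open>A a b\<close> it is the minor on the rows \<open>S\<close> and the columns \<open>f b\<close>, \<open>b \<in> S\<close>, so that row sets and column choices
  need not be enumerated in increasing order.
\<close>

definition leib :: "'i set \<Rightarrow> ('i \<Rightarrow> 'i \<Rightarrow> 'a :: comm_ring_1) \<Rightarrow> 'a" where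
  "leib S A = (\<Sum>p | p permutes S. of_int (sign p) * (\<Prod>a\<in>S. A a (p a)))"

lemma leib_cong: "(\<And>a b. a \<in> S \<Longrightarrow> b \<in> S \<Longrightarrow> A a b = B a b) \<Longrightarrow> leib S A = leib S B"
  unfolding leib_def by (intro sum.cong refl arg_cong2[of _ _ _ _ "(*)"] prod.cong) (auto simp: permutes_in_image)

lemma leib_empty [simp]: "leib {} A = 1"
  by (simp add: leib_def)

text \<open>
  Laplace expansion without renumbering: to delete row \<open>c\<close> and column \<open>b\<close> one transposes \<open>b\<close>
  and \<open>c\<close> among the columns and then keeps the common index set \<open>S\<close>.
\<close>

lemma leib_expand_row:
  fixes A :: "nat \<Rightarrow> nat \<Rightarrow> 'a :: comm_ring_1"
  assumes "finite S" "c \<notin> S"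
  shows "leib (insert c S) A = (\<Sum>b\<in>insert c S. of_int (sign (Transposition.transpose c b)) * (A c b * leib S (\<lambda>a d. A a (Transposition.transpose c b d))))"
proof -
  have "of_int (sign (Transposition.transpose c b \<circ> q)) * (\<Prod>a\<in>insert c S. A a ((Transposition.transpose c b \<circ> q) a))
      = of_int (sign (Transposition.transpose c b)) * (A c b * (of_int (sign q) * (\<Prod>a\<in>S. A a (Transposition.transpose c b (q a)))))"
    if "q permutes S" for b q
  proof -
    have "sign (Transposition.transpose c b \<circ> q) = sign (Transposition.transpose c b) * sign q"
      using that assms by (intro sign_compose permutation_swap_id) (auto simp: permutation_permutes)
    moreover have "q c = c" using that assms(2) by (rule permutes_not_in)
    ultimately show ?thesis using assms by (simp add: mult_ac)
  qed
  then show ?thesis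
    unfolding leib_def sum_over_permutations_insert[OF assms] by (simp add: sum_distrib_left)
qed

lemma leib_row_linear:
  fixes A :: "nat \<Rightarrow> nat \<Rightarrow> 'a :: comm_ring_1"
  assumes "finite S" "c \<in> S"
  shows "leib S (A(c := (\<lambda>b. x * (u b + v b)))) = x * (leib S (A(c := u)) + leib S (A(c := v)))"
proof -
  define T where "T = S - {c}"
  have S: "S = insert c T" and T: "finite T" "c \<notin> T" using assms by (auto simp: T_def)
  have *: "leib T (\<lambda>a d. (A(c := w)) a (f d)) = leib T (\<lambda>a d. A a (f d))" for w f
    using T by (intro leib_cong) auto
  show ?thesis
    unfolding S leib_expand_row[OF T] * by (simp add: sum_distrib_left sum.distrib algebra_simps)
qed

lemma leib_perm_cols:
  fixes A :: "'i \<Rightarrow> 'i \<Rightarrow> 'a :: comm_ring_1"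
  assumes "finite S" "\<sigma> permutes S"
  shows "leib S (\<lambda>a b. A a (\<sigma> b)) = of_int (sign \<sigma>) * leib S A"
proof -
  have *: "sign (\<sigma> \<circ> p) = sign \<sigma> * sign p" if "p permutes S" for p
    using that assms by (intro sign_compose) (auto simp: permutation_permutes)
  have sq: "of_int (sign \<sigma>) * (of_int (sign \<sigma>) * z) = (z :: 'a)" for z
    by (simp add: sign_def)
  have "leib S A = (\<Sum>p | p permutes S. of_int (sign (\<sigma> \<circ> p)) * (\<Prod>a\<in>S. A a ((\<sigma> \<circ> p) a)))"
    unfolding leib_def by (rule setum_permutations_compose_left[OF assms(2)])
  also have "\<dots> = of_int (sign \<sigma>) * leib S (\<lambda>a b. A a (\<sigma> b))"
    unfolding leib_def by (simp add: * sum_distrib_left mult_ac)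
  finally show ?thesis by (simp add: sq)
qed

lemma leib_transpose:
  fixes A :: "'i \<Rightarrow> 'i \<Rightarrow> 'a :: comm_ring_1"
  assumes "finite S"
  shows "leib S (\<lambda>a b. A b a) = leib S A"
proof -
  have "leib S (\<lambda>a b. A b a) = (\<Sum>p | p permutes S. of_int (sign (inv_into UNIV p)) * (\<Prod>a\<in>S. A (inv_into UNIV p a) a))"
    unfolding leib_def by (rule sum_permutations_inverse)
  also have "\<dots> = leib S A"
    unfolding leib_def
  proof (intro sum.cong refl, goal_cases)
    case (1 p)
    then have p: "p permutes S" by simp
    then have "sign (inv_into UNIV p) = sign p" using assms by (intro sign_inverse) (auto simp: permutation_permutes)
    moreover have "(\<Prod>a\<in>S. A (inv_into UNIV p a) a) = (\<Prod>a\<in>S. A a (p a))"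
      by (subst prod.permute[OF p]) (simp add: o_def permutes_inverses(2)[OF p])
    ultimately show ?case by simp
  qed
  finally show ?thesis .
qed

lemma leib_perm_rows:
  fixes A :: "'i \<Rightarrow> 'i \<Rightarrow> 'a :: comm_ring_1"
  assumes "finite S" "\<sigma> permutes S"
  shows "leib S (\<lambda>a b. A (\<sigma> a) b) = of_int (sign \<sigma>) * leib S A"
proof -
  have "leib S (\<lambda>a b. A (\<sigma> a) b) = leib S (\<lambda>a b. A (\<sigma> b) a)"
    using leib_transpose[OF assms(1), of "\<lambda>a b. A (\<sigma> b) a"] by simp
  also have "\<dots> = of_int (sign \<sigma>) * leib S (\<lambda>a b. A b a)"
    by (rule leib_perm_cols[OF assms])
  finally show ?thesis by (simp only: leib_transpose[OF assms(1), of A])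
qed

lemma leib_equal_rows:
  fixes A :: "'i \<Rightarrow> 'i \<Rightarrow> 'a :: {idom, ring_char_0}"
  assumes "finite S" "r \<in> S" "s \<in> S" "r \<noteq> s" "A r = A s"
  shows "leib S A = 0"
proof -
  have "(\<lambda>a b. A (Transposition.transpose r s a) b) = A"
    using assms(5) by (auto simp: fun_eq_iff Transposition.transpose_def)
  then have "leib S A = - leib S A"
    using leib_perm_rows[OF assms(1) permutes_swap_id[OF assms(2,3)], of A] assms(4)
    by (simp add: sign_swap_id)
  then have "leib S A + leib S A = 0" by (metis add.right_inverse)
  then have "2 * leib S A = 0" by (simp only: mult_2)
  then show ?thesis by simp
qed

lemma leib_zero_col:
  assumes "finite S" "b \<in> S" "\<And>a. a \<in> S \<Longrightarrow> A a b = 0"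
  shows "leib S A = 0"
  unfolding leib_def
proof (intro sum.neutral ballI, goal_cases)
  case (1 p)
  then have p: "p permutes S" by simp
  then have "inv_into UNIV p b \<in> S" "p (inv_into UNIV p b) = b"
    using assms(2) by (auto simp: permutes_inverses permutes_in_image permutes_inv)
  then have "\<exists>a\<in>S. A a (p a) = 0" using assms(3) by (intro bexI[of _ "inv_into UNIV p b"]) auto
  then show ?case using assms(1) by (simp add: prod_zero)
qed

text \<open>
  A simultaneous renaming of rows and columns conjugates the permutations in Leibniz' formula,
  which preserves signs. It is used to replace row \<open>r + 1\<close> by row \<open>r\<close> in a row set.
\<close>

lemma leib_relabel:
  fixes A :: "'i \<Rightarrow> 'i \<Rightarrow> 'a :: comm_ring_1"
  assumes "finite S"
  shows "leib S (\<lambda>a b. A (Transposition.transpose x y a) (Transposition.transpose x y b)) = leib (Transposition.transpose x y ` S) A"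
proof -
  let ?t = "Transposition.transpose x y"
  have perm: "?t \<circ> p \<circ> ?t permutes ?t ` U" if "p permutes U" for p U
  proof (rule bij_imp_permutes)
    have "bij_betw ?t (?t ` U) U" "bij_betw ?t U (?t ` U)"
      by (simp_all add: bij_betw_def image_image)
    with permutes_imp_bij[OF that] show "bij_betw (?t \<circ> p \<circ> ?t) (?t ` U) (?t ` U)"
      by (metis bij_betw_trans)
    fix z assume "z \<notin> ?t ` U"
    then have "?t z \<notin> U" by (metis image_eqI transpose_involutory)
    then show "(?t \<circ> p \<circ> ?t) z = z" using that by (simp add: permutes_not_in)
  qed
  have tt: "?t ` ?t ` S = S" by (simp add: image_image)
  have sgn: "sign (?t \<circ> p \<circ> ?t) = sign p" if "p permutes U" "finite U" for p U
  proof -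
    have "permutation p" using that by (auto simp: permutation_permutes)
    then show ?thesis
      by (simp add: sign_compose permutation_compose permutation_swap_id sign_def evenperm_comp)
  qed
  have "leib (?t ` S) A = (\<Sum>p | p permutes S. of_int (sign p) * (\<Prod>a\<in>?t ` S. A a ((?t \<circ> p \<circ> ?t) a)))"
    unfolding leib_def
    by (rule sum.reindex_bij_witness[of _ "\<lambda>p. ?t \<circ> p \<circ> ?t" "\<lambda>p. ?t \<circ> p \<circ> ?t"])
       (use perm[of _ S] perm[of _ "?t ` S"] tt sgn[of _ "?t ` S"] assms in \<open>auto simp: fun_eq_iff\<close>)
  also have "\<dots> = leib S (\<lambda>a b. A (?t a) (?t b))"
    unfolding leib_def by (simp add: prod.reindex)
  finally show ?thesis by simp
qed

lemma leib_row_sum: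
  fixes R T :: "_ \<Rightarrow> _ \<Rightarrow> 'a :: comm_ring_1"
  assumes "finite S" "finite K"
  shows "leib S (\<lambda>a b. \<Sum>\<kappa>\<in>K. R a \<kappa> * T \<kappa> b) =
    (\<Sum>f\<in>S \<rightarrow>\<^sub>E K. (\<Prod>a\<in>S. R a (f a)) * leib S (\<lambda>a b. T (f a) b))"
proof -
  have "leib S (\<lambda>a b. \<Sum>\<kappa>\<in>K. R a \<kappa> * T \<kappa> b)
    = (\<Sum>p | p permutes S. \<Sum>f\<in>S \<rightarrow>\<^sub>E K. (\<Prod>a\<in>S. R a (f a)) * (of_int (sign p) * (\<Prod>a\<in>S. T (f a) (p a))))"
    unfolding leib_def using assms
    by (simp add: prod_sum_PiE prod.distrib sum_distrib_left mult_ac)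
  also have "\<dots> = (\<Sum>f\<in>S \<rightarrow>\<^sub>E K. (\<Prod>a\<in>S. R a (f a)) * leib S (\<lambda>a b. T (f a) b))"
    unfolding leib_def sum_distrib_left by (rule sum.swap)
  finally show ?thesis .
qed

text \<open>
  A form of the Cauchy-Binet formula that sums over all maps \<open>f\<close> from rows to columns instead of
  column sets. Expanding the rows of the Gram matrix gives \<open>\<Sum>f. (\<Prod>a. R a (f a)) * L f\<close> with \<open>L f\<close> the
  minor for \<open>f\<close>; averaging this over \<open>f \<circ> p\<close> for all permutations \<open>p\<close> turns the product
  into a second copy of \<open>L f\<close>.
\<close>

lemma leib_gram:
  fixes R :: "_ \<Rightarrow> _ \<Rightarrow> 'a :: {comm_ring_1, ring_char_0}"
  assumes "finite S" "finite K"
  shows "fact (card S) * leib S (\<lambda>a b. \<Sum>\<kappa>\<in>K. R a \<kappa> * R b \<kappa>) =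
    (\<Sum>f\<in>S \<rightarrow>\<^sub>E K. (leib S (\<lambda>a b. R a (f b)))\<^sup>2)"
proof -
  define L where "L f = leib S (\<lambda>a b. R a (f b))" for f
  define G where "G = leib S (\<lambda>a b. \<Sum>\<kappa>\<in>K. R a \<kappa> * R b \<kappa>)"
  have G: "G = (\<Sum>f\<in>S \<rightarrow>\<^sub>E K. (\<Prod>a\<in>S. R a (f a)) * L f)"
    unfolding G_def L_def
    unfolding leib_row_sum[OF assms, of R "\<lambda>\<kappa> b. R b \<kappa>"]
    by (intro sum.cong refl arg_cong2[of _ _ _ _ "(*)"] leib_transpose[OF assms(1)])
  have Gp: "G = (\<Sum>f\<in>S \<rightarrow>\<^sub>E K. of_int (sign p) * (\<Prod>a\<in>S. R a (f (p a))) * L f)" if p: "p permutes S" for p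
  proof -
    have L_p: "L (restrict (f \<circ> p) S) = of_int (sign p) * L f" for f
    proof -
      have "L (restrict (f \<circ> p) S) = leib S (\<lambda>a b. R a (f (p b)))"
        unfolding L_def by (intro leib_cong) auto
      also have "\<dots> = of_int (sign p) * L f"
        unfolding L_def by (rule leib_perm_cols[OF assms(1) p])
      finally show ?thesis .
    qed
    have "G = (\<Sum>f\<in>S \<rightarrow>\<^sub>E K. (\<Prod>a\<in>S. R a (restrict (f \<circ> p) S a)) * L (restrict (f \<circ> p) S))"
      unfolding G
    proof (rule sum.reindex_bij_witness[of _ "\<lambda>f. restrict (f \<circ> p) S" "\<lambda>f. restrict (f \<circ> inv_into UNIV p) S"], goal_cases)
      case (1 f) then show ?case
        by (auto simp: fun_eq_iff restrict_def PiE_iff extensional_def permutes_inverses[OF p] permutes_in_image[OF p])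
    next
      case (2 f) then show ?case
        by (auto simp: PiE_iff permutes_in_image[OF permutes_inv[OF p]])
    next
      case (3 f) then show ?case
        by (auto simp: fun_eq_iff restrict_def PiE_iff extensional_def permutes_inverses[OF p] permutes_in_image[OF permutes_inv[OF p]])
    next
      case (4 f) then show ?case
        by (auto simp: PiE_iff permutes_in_image[OF p])
    next
      case (5 f)
      have "restrict (restrict (f \<circ> inv_into UNIV p) S \<circ> p) S = f"
        using 5 by (auto simp: fun_eq_iff restrict_def PiE_iff extensional_def permutes_inverses[OF p] permutes_in_image[OF p])
      then show ?case by simp
    qed
    then show ?thesis by (simp add: L_p mult_ac)
  qed
  have "fact (card S) * G = (\<Sum>p | p permutes S. G)"
    using assms by (simp add: card_permutations)
  also have "\<dots> = (\<Sum>p | p permutes S. \<Sum>f\<in>S \<rightarrow>\<^sub>E K. of_int (sign p) * (\<Prod>a\<in>S. R a (f (p a))) * L f)"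
    by (intro sum.cong refl Gp) simp
  also have "\<dots> = (\<Sum>f\<in>S \<rightarrow>\<^sub>E K. L f * L f)"
    by (subst sum.swap, intro sum.cong refl) (simp add: L_def leib_def sum_distrib_right)
  finally show ?thesis by (simp add: G_def L_def power2_eq_square)
qed

text \<open>
  Choose in each row either the diagonal summand, which forces the permutation to fix that row, or
  the entry of \<open>N\<close>; \<open>S\<close> is the set of rows of the second kind.
\<close>

lemma leib_diag_add:
  fixes N :: "'i \<Rightarrow> 'i \<Rightarrow> 'a :: comm_ring_1"
  assumes "finite A"
  shows "leib A (\<lambda>a b. N a b + (if a = b then d a else 0)) = (\<Sum>S\<in>Pow A. (\<Prod>a\<in>A - S. d a) * leib S N)"
proof -
  have "leib A (\<lambda>a b. N a b + (if a = b then d a else 0))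
    = (\<Sum>p | p permutes A. \<Sum>S\<in>Pow A. of_int (sign p) * ((\<Prod>a\<in>S. N a (p a)) * (\<Prod>a\<in>A - S. if a = p a then d a else 0)))"
    unfolding leib_def by (simp add: prod_add[OF assms] sum_distrib_left)
  also have "\<dots> = (\<Sum>S\<in>Pow A. \<Sum>p | p permutes A. of_int (sign p) * ((\<Prod>a\<in>S. N a (p a)) * (\<Prod>a\<in>A - S. if a = p a then d a else 0)))"
    by (rule sum.swap)
  also have "\<dots> = (\<Sum>S\<in>Pow A. (\<Prod>a\<in>A - S. d a) * leib S N)"
  proof (intro sum.cong refl)
    fix S assume "S \<in> Pow A"
    then have S: "S \<subseteq> A" "finite S" using assms finite_subset by auto
    have "(\<Sum>p | p permutes A. of_int (sign p) * ((\<Prod>a\<in>S. N a (p a)) * (\<Prod>a\<in>A - S. if a = p a then d a else 0)))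
      = (\<Sum>p | p permutes S. of_int (sign p) * ((\<Prod>a\<in>S. N a (p a)) * (\<Prod>a\<in>A - S. if a = p a then d a else 0)))"
    proof (rule sum.mono_neutral_right)
      show "finite {p. p permutes A}" by (rule finite_permutations[OF assms])
      show "{p. p permutes S} \<subseteq> {p. p permutes A}" using S permutes_subset by blast
      show "\<forall>p\<in>{p. p permutes A} - {p. p permutes S}. of_int (sign p) * ((\<Prod>a\<in>S. N a (p a)) * (\<Prod>a\<in>A - S. if a = p a then d a else 0)) = 0"
      proof
        fix p assume p: "p \<in> {p. p permutes A} - {p. p permutes S}"
        then have "\<exists>a\<in>A - S. (if a = p a then d a else 0) = 0" using permutes_superset[of p A S] by (metis mem_Collect_eq DiffE)
        then have "(\<Prod>a\<in>A - S. if a = p a then d a else 0) = 0"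
          using assms by (intro prod_zero) auto
        then show "of_int (sign p) * ((\<Prod>a\<in>S. N a (p a)) * (\<Prod>a\<in>A - S. if a = p a then d a else 0)) = 0" by simp
      qed
    qed
    also have "\<dots> = (\<Sum>p | p permutes S. (\<Prod>a\<in>A - S. d a) * (of_int (sign p) * (\<Prod>a\<in>S. N a (p a))))"
    proof (intro sum.cong refl, goal_cases)
      case (1 p)
      then have "(\<Prod>a\<in>A - S. if a = p a then d a else 0) = (\<Prod>a\<in>A - S. d a)"
        by (intro prod.cong) (auto dest: permutes_not_in)
      then show ?case by (simp add: mult_ac)
    qed
    finally show "(\<Sum>p | p permutes A. of_int (sign p) * ((\<Prod>a\<in>S. N a (p a)) * (\<Prod>a\<in>A - S. if a = p a then d a else 0)))
      = (\<Prod>a\<in>A - S. d a) * leib S N" by (simp add: leib_def sum_distrib_left)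
  qed
  finally show ?thesis .
qed

lemma det_eq_leib: "Determinant.det (mat n n (\<lambda>(a, b). A a b)) = leib {0..<n} A"
  unfolding leib_def by (subst det_def'[of _ n]) (auto intro!: sum.cong prod.cong simp: permutes_in_image sign_def)

lemma leib_scale: "finite S \<Longrightarrow> leib S (\<lambda>a b. x * A a b) = x ^ card S * leib S A"
  unfolding leib_def by (simp add: prod.distrib sum_distrib_left mult_ac)

lemma deg_le_sign: "deg_le z q \<Longrightarrow> deg_le (of_int (sign p) * z) q"
  by (auto simp: sign_def deg_le_def uminus_puiseux.rep_eq)

lemma real_sign: "z \<in> real_puiseux \<Longrightarrow> of_int (sign p) * z \<in> real_puiseux"
  by (auto simp: sign_def real_minus)

lemma real_leib:
  assumes "\<And>a b. a \<in> S \<Longrightarrow> A a b \<in> real_puiseux"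
  shows "leib S A \<in> real_puiseux"
  unfolding leib_def using assms by (intro real_sum real_sign real_prod)

section \<open>Heaviest families of disjoint paths\<close>

lemma swap_up_sums:
  fixes f :: "nat \<Rightarrow> 'a :: ab_group_add"
  assumes "finite A" "s \<in> A" "Suc s \<notin> A"
  shows "sum f (insert (Suc s) (A - {s})) = sum f A + f (Suc s) - f s"
  using assms by (simp add: sum_diff1)

lemma swap_down_sums:
  fixes f :: "nat \<Rightarrow> 'a :: ab_group_add"
  assumes "finite A" "s \<notin> A" "Suc s \<in> A"
  shows "sum f (insert s (A - {Suc s})) = sum f A + f s - f (Suc s)"
  using assms by (simp add: sum_diff1)

lemma up_closed_eq_interval:
  assumes "A \<subseteq> {..<n}" "\<And>s. s \<in> A \<Longrightarrow> Suc s < n \<Longrightarrow> Suc s \<in> A"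
  shows "A = {n - card A..<n}"
proof (cases "A = {}")
  case False
  define a where "a = Min A"
  have fin: "finite A" using assms(1) finite_subset by blast
  with False have a: "a \<in> A" "\<And>s. s \<in> A \<Longrightarrow> a \<le> s" by (auto simp: a_def)
  have "s \<in> A" if "a \<le> s" "s < n" for s
    using that by (induction s rule: dec_induct) (auto simp: a assms(2))
  with a assms(1) have A: "A = {a..<n}" by force
  then have "card A = n - a" by simp
  moreover have "a \<le> n" using a assms(1) by auto
  ultimately show ?thesis using A by simp
qed simp

text \<open>
  Data for a network on the vertices \<open>(r, c)\<close>, \<open>c \<le> r < n\<close>. The second diagonal matrix has the exponents
  \<open>- \<alpha> 0 r\<close> relative to the first one, and \<open>\<alpha> c\<close>, on the rows \<open>r \<ge> c\<close>, takes the place of \<open>\<alpha> 0\<close> for the part of the network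
  from column \<open>c\<close> on; consecutive sequences interlace. The number \<open>e c r\<close> is the weight of the vertical path in column \<open>c\<close>
  from row \<open>r\<close> up to the diagonal. For a hive, the first two assumptions and the last one are the three
  types of rhombus inequality, and the third is an identity.
\<close>

locale path_weights =
  fixes n :: nat and \<alpha> e :: "nat \<Rightarrow> nat \<Rightarrow> rat"
  assumes \<alpha>_up: "c \<le> r \<Longrightarrow> Suc r < n \<Longrightarrow> \<alpha> c (Suc r) \<le> \<alpha> (Suc c) (Suc r)"
    and \<alpha>_down: "c \<le> r \<Longrightarrow> Suc r < n \<Longrightarrow> \<alpha> (Suc c) (Suc r) \<le> \<alpha> c r"
    and e_step: "c \<le> r \<Longrightarrow> Suc r < n \<Longrightarrow> e c (Suc r) - e c r = \<alpha> (Suc c) (Suc r) - \<alpha> c (Suc r)"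
    and e_diag: "c \<le> r \<Longrightarrow> Suc r < n \<Longrightarrow> e (Suc c) (Suc r) \<le> e c r"
begin

text \<open>
  The weight of the vertex \<open>(r, c)\<close>, so that the weights of \<open>(c, c), \<dots>, (r, c)\<close> add up to \<open>e c r\<close>.
\<close>

definition wt :: "nat \<Rightarrow> nat \<Rightarrow> rat" where
  "wt c r = (if r \<le> c then e c c else e c r - e c (r - 1))"

text \<open>
  If \<open>M S\<close> is the largest weight of a disjoint path family that enters the columns \<open>> c\<close> in the rows \<open>S\<close>,
  then \<open>sweep c M r S\<close> is the largest weight when the rows \<open>\<le> r\<close> of \<open>S\<close> are entered one column
  earlier, at column \<open>c\<close>. A path at \<open>(r, c)\<close> collects the weight of this vertex and then either turns to the next column in row \<open>r\<close> or
  moves up to row \<open>r - 1\<close>, which must be free; a path at \<open>(c, c)\<close> ends. Rows \<open>r < c\<close> do not occur,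
  and for them the value is that of \<open>r = c\<close>.
\<close>

primrec sweep :: "nat \<Rightarrow> (nat set \<Rightarrow> rat) \<Rightarrow> nat \<Rightarrow> nat set \<Rightarrow> rat" where
  "sweep c M 0 S = (if c \<in> S then wt c c + M (S - {c}) else M S)"
| "sweep c M (Suc r) S =
     (if Suc r \<le> c then if c \<in> S then wt c c + M (S - {c}) else M S
      else if Suc r \<in> S
        then wt c (Suc r) + (if r \<in> S then sweep c M r S
               else max (sweep c M r S) (sweep c M r (insert r (S - {Suc r}))))
        else sweep c M r S)"

lemma sweep_diag: "sweep c M c S = (if c \<in> S then wt c c + M (S - {c}) else M S)"
  by (cases c) auto

lemma sweep_Suc:
  "c \<le> r \<Longrightarrow> sweep c M (Suc r) S =
     (if Suc r \<in> S
      then wt c (Suc r) + (if r \<in> S then sweep c M r S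
             else max (sweep c M r S) (sweep c M r (insert r (S - {Suc r}))))
      else sweep c M r S)"
  by auto

declare sweep.simps(2) [simp del]

lemma sweep_above:
  assumes "c \<le> r" "S \<subseteq> {r<..}"
  shows "sweep c M r S = M S"
  using assms
proof (induction r rule: dec_induct)
  case base
  then show ?case by (auto simp: sweep_diag)
next
  case (step r)
  moreover from step have "S \<subseteq> {r<..}" "Suc r \<notin> S" by auto
  ultimately show ?case by (simp add: sweep_Suc)
qed

lemma wt_Suc: "c \<le> r \<Longrightarrow> Suc r < n \<Longrightarrow> wt c (Suc r) = \<alpha> (Suc c) (Suc r) - \<alpha> c (Suc r)"
  using e_step[of c r] by (simp add: wt_def)

lemma wt_nonneg: "c \<le> r \<Longrightarrow> Suc r < n \<Longrightarrow> 0 \<le> wt c (Suc r)"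
  using \<alpha>_up[of c r] by (simp add: wt_Suc)

text \<open>
  Moving a path to the next lower row while the first diagonal matrix takes over the row it leaves.
\<close>

definition shift_up :: "nat \<Rightarrow> (nat set \<Rightarrow> rat) \<Rightarrow> bool" where
  "shift_up c M \<longleftrightarrow> (\<forall>S s. c \<le> s \<longrightarrow> Suc s < n \<longrightarrow> s \<in> S \<longrightarrow> Suc s \<notin> S \<longrightarrow> M S \<le> M (insert (Suc s) (S - {s})))"

text \<open>
  The same exchange in the opposite direction against the second diagonal matrix, whose entries have the exponents \<open>- a s\<close>.
\<close>

definition shift_down :: "nat \<Rightarrow> (nat \<Rightarrow> rat) \<Rightarrow> (nat set \<Rightarrow> rat) \<Rightarrow> bool" where
  "shift_down c a M \<longleftrightarrow> (\<forall>S s. c \<le> s \<longrightarrow> Suc s < n \<longrightarrow> S \<subseteq> {c..} \<longrightarrow> s \<notin> S \<longrightarrow> Suc s \<in> S \<longrightarrow>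
      M S + a (Suc s) \<le> M (insert s (S - {Suc s})) + a s)"

text \<open>
  Removal of the topmost path. This bounds what it can contribute by a quantity that does not
  depend on the other paths; it is what makes the exchange at the top row and the evaluation on intervals work.
\<close>

definition drop_first :: "nat \<Rightarrow> (nat \<Rightarrow> rat) \<Rightarrow> (nat set \<Rightarrow> rat) \<Rightarrow> bool" where
  "drop_first c d M \<longleftrightarrow> (\<forall>t U. c \<le> t \<longrightarrow> t < n \<longrightarrow> U \<subseteq> {t<..} \<longrightarrow> M (insert t U) \<le> M U + d t)"

text \<open>
  The exchange of \<open>s\<close> and \<open>s + 1\<close> fails for \<open>s = r\<close>, where row \<open>r\<close> is entered at column \<open>c\<close> but row \<open>r + 1\<close> only at
  column \<open>c + 1\<close>. Elsewhere a path from \<open>s + 1\<close> can imitate one from \<open>s\<close> by moving up first, which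
  costs nothing as the weight of \<open>(s + 1, c)\<close> is nonnegative.
\<close>

lemma sweep_shift_up:
  assumes M: "shift_up (Suc c) M"
  assumes "c \<le> r" "r < n" "c \<le> s" "Suc s < n" "s \<noteq> r" "s \<in> S" "Suc s \<notin> S"
  shows "sweep c M r S \<le> sweep c M r (insert (Suc s) (S - {s}))"
  using assms(2-)
proof (induction r arbitrary: s S rule: less_induct)
  case (less r)
  show ?case
  proof (cases "r = c")
    case True
    with less.prems have sc: "Suc c \<le> s" by auto
    let ?S = "if c \<in> S then S - {c} else S"
    have "M ?S \<le> M (insert (Suc s) (?S - {s}))"
      using M less.prems sc unfolding shift_up_def by auto
    moreover have "insert (Suc s) (?S - {s}) = (if c \<in> S then insert (Suc s) (S - {s}) - {c} else insert (Suc s) (S - {s}))"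
      using sc by auto
    ultimately show ?thesis using True sc by (auto simp: sweep_diag)
  next
    case False
    with less.prems obtain q where r: "r = Suc q" and cq: "c \<le> q"
      by (cases r) auto
    note step = sweep_Suc[OF cq, of M]
    have wq: "0 \<le> wt c r" using cq less.prems by (simp add: r wt_nonneg)
    define S2 where "S2 = insert (Suc s) (S - {s})"
    show ?thesis
    proof (cases "s = q")
      case True
      have "sweep c M q S = sweep c M q (insert q (S2 - {r}))"
        using True less.prems by (intro arg_cong[of _ _ "sweep c M q"]) (auto simp: S2_def r)
      then show ?thesis
        using True less.prems wq by (simp add: r step S2_def)
    next
      case sq: False
      have IH: "sweep c M q S \<le> sweep c M q S2"
        unfolding S2_def using less.prems sq cq by (intro less.IH) (auto simp: r)
      show ?thesis
      proof (cases "r \<in> S")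
        case False
        then have "r \<notin> S2" using sq by (auto simp: S2_def r)
        with False IH show ?thesis by (simp add: r step flip: S2_def)
      next
        case rS: True
        then have rS2: "r \<in> S2" using less.prems by (auto simp: S2_def r)
        show ?thesis
        proof (cases "q \<in> S")
          case True
          then have "q \<in> S2" using sq by (auto simp: S2_def)
          with True rS rS2 IH show ?thesis by (simp add: r step flip: S2_def)
        next
          case qS: False
          define S' where "S' = insert q (S - {r})"
          have "sweep c M q S' \<le> (if q \<in> S2 then sweep c M q S2 else sweep c M q (insert q (S2 - {r})))"
          proof (cases "Suc s = q")
            case True
            \<comment> \<open>Rows \<open>s\<close> and \<open>s + 2\<close> are occupied and the lower path moves up: two steps of the recursion are needed.\<close>
            have cs: "c \<le> s" "s < r" using less.prems True r by auto
            note step' = sweep_Suc[OF cs(1), of M]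
            have "sweep c M q S' = wt c q + sweep c M s S'"
              using True less.prems by (simp add: S'_def r step' flip: True)
            also have "sweep c M s S' \<le> sweep c M s (insert r (S' - {q}))"
              using less.IH[of s q S'] less.prems cs r True by (auto simp: S'_def)
            also have "insert r (S' - {q}) = S" using rS qS by (auto simp: S'_def r)
            also have "S = insert s (S2 - {q})" using less.prems True by (auto simp: S2_def)
            also have "wt c q + sweep c M s (insert s (S2 - {q})) \<le> sweep c M q S2"
              by (simp add: S2_def step' flip: True)
            finally show ?thesis using True by (simp add: S2_def)
          next
            case False
            have "sweep c M q S' \<le> sweep c M q (insert (Suc s) (S' - {s}))"
              using less.prems sq cq False r qS by (intro less.IH) (auto simp: S'_def)
            also have "insert (Suc s) (S' - {s}) = insert q (S2 - {r})"
              using sq False less.prems r by (auto simp: S'_def S2_def)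
            finally show ?thesis using qS False sq by (simp add: S2_def)
          qed
          with IH rS rS2 qS show ?thesis
            by (auto simp: r step S'_def simp flip: S2_def)
        qed
      qed
    qed
  qed
qed

text \<open>
  The comparison exponents at the stage where rows \<open>\<le> r\<close> are entered at column \<open>c\<close> and rows \<open>> r\<close> at column \<open>c + 1\<close>.
\<close>

abbreviation snake :: "nat \<Rightarrow> nat \<Rightarrow> nat \<Rightarrow> rat" where
  "snake c r s \<equiv> if s \<le> r then \<alpha> c s else \<alpha> (Suc c) s"

text \<open>
  Here a path from \<open>s\<close> imitates one from \<open>s + 1\<close>: if the latter first moves up, the former skips this step, and
  \<open>\<alpha> (c + 1) (s + 1) \<le> \<alpha> c s\<close> pays for the lost weight; if it turns right, induction applies to the next column. At the diagonal, where
  the path from row \<open>c\<close> ends, the comparison is between ending now and continuing, and \<open>drop_first\<close> decides it.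
\<close>

lemma sweep_shift_down:
  assumes M: "shift_down (Suc c) (\<alpha> (Suc c)) M" and D: "drop_first (Suc c) (e (Suc c)) M"
    and "c \<le> r" "r < n" "c \<le> s" "Suc s < n" "S \<subseteq> {c..}" "s \<notin> S" "Suc s \<in> S"
  shows "sweep c M r S + snake c r (Suc s) \<le> sweep c M r (insert s (S - {Suc s})) + snake c r s"
  using assms(3-)
proof (induction r arbitrary: s S rule: dec_induct)
  case base
  show ?case
  proof (cases "s = c")
    case True
    define U where "U = S - {Suc c}"
    have U: "U \<subseteq> {Suc c<..}" and cS: "Suc c \<in> S"
      using base True by (auto simp: U_def nat_less_le Suc_le_eq subset_eq)
    then have "S = insert (Suc c) U" by (auto simp: U_def)
    with D U base True have "M S \<le> M U + e (Suc c) (Suc c)"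
      by (auto simp: drop_first_def)
    moreover have "sweep c M c S = M S"
      using base True by (simp add: sweep_diag)
    moreover have "sweep c M c (insert c U) = wt c c + M U"
      using U by (auto simp: sweep_diag intro!: arg_cong[of _ _ M])
    ultimately show ?thesis
      using e_diag[of c c] \<alpha>_down[of c c] base True by (simp add: wt_def flip: U_def)
  next
    case False
    let ?S = "S - {c}"
    have "M ?S + \<alpha> (Suc c) (Suc s) \<le> M (insert s (?S - {Suc s})) + \<alpha> (Suc c) s"
    proof -
      have "Suc c \<le> s" "Suc s < n" "?S \<subseteq> {Suc c..}" "s \<notin> ?S" "Suc s \<in> ?S"
        using base False by (auto simp: subset_eq Suc_le_eq nat_less_le)
      with M show ?thesis unfolding shift_down_def by blast
    qed
    moreover have "insert s (?S - {Suc s}) = insert s (S - {Suc s}) - {c}"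
      using False by auto
    moreover have "c \<notin> S \<Longrightarrow> S - {c} = S" by auto
    moreover have "c \<notin> S \<Longrightarrow> insert s (S - {Suc s}) - {c} = insert s (S - {Suc s})"
      using False by auto
    ultimately show ?thesis using False base by (auto simp: sweep_diag)
  qed
next
  case (step q)
  define r where r: "r = Suc q"
  note cq = \<open>c \<le> q\<close>
  note step_eq = sweep_Suc[OF cq, of M, folded r]
  define S2 where "S2 = insert s (S - {Suc s})"
  have qn: "r < n" using step.prems by (simp add: r)
  have wr: "wt c r = \<alpha> (Suc c) r - \<alpha> c r" using cq qn by (simp add: r wt_Suc)
  have IH: "sweep c M q S + snake c q (Suc s) \<le> sweep c M q S2 + snake c q s"
    unfolding S2_def using step.prems by (intro step.IH) auto
  have "sweep c M r S + snake c r (Suc s) \<le> sweep c M r S2 + snake c r s"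
  proof -
    consider "s = r" | "s = q" | "s \<noteq> r" "s \<noteq> q" by blast
    then show ?thesis
    proof cases
      case 1
      then have "sweep c M r S = sweep c M q S"
        using step.prems by (simp add: step_eq)
      moreover have "r \<in> S2" "q \<in> S2 \<or> q \<notin> S2" using 1 by (auto simp: S2_def)
      then have "sweep c M r S2 \<ge> wt c r + sweep c M q S2"
        by (auto simp: step_eq)
      ultimately show ?thesis using IH 1 wr by (simp add: r)
    next
      case 2
      have S: "r \<in> S" "q \<notin> S" "r \<notin> S2" using 2 step.prems by (auto simp: r S2_def)
      have "S2 = insert q (S - {r})" using 2 by (simp add: S2_def r)
      then have "sweep c M r S = wt c r + max (sweep c M q S) (sweep c M q S2)"
        "sweep c M r S2 = sweep c M q S2"
        using S by (simp_all add: step_eq)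
      moreover have "\<alpha> (Suc c) r \<le> \<alpha> c q" using \<alpha>_down[OF cq] qn by (simp add: r)
      ultimately show ?thesis using IH 2 wr by (simp add: r max_def)
    next
      case 3
      have eqs: "snake c q (Suc s) = snake c r (Suc s)" "snake c q s = snake c r s"
        using 3 by (auto simp: r)
      have mem: "r \<in> S2 \<longleftrightarrow> r \<in> S" using 3 by (auto simp: r S2_def)
      show ?thesis
      proof (cases "r \<in> S")
        case False
        with mem IH show ?thesis unfolding eqs by (simp add: step_eq)
      next
        case rS: True
        show ?thesis
        proof (cases "q \<in> S")
          case True
          show ?thesis
          proof (cases "q \<in> S2")
            case True
            with rS mem \<open>q \<in> S\<close> IH show ?thesis unfolding eqs by (simp add: step_eq)
          next
            case False
            with rS mem \<open>q \<in> S\<close> have "sweep c M r S = wt c r + sweep c M q S"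
              "sweep c M r S2 \<ge> wt c r + sweep c M q S2" by (simp_all add: step_eq)
            with IH show ?thesis unfolding eqs by linarith
          qed
        next
          case False
          define S' where "S' = insert q (S - {r})"
          have "sweep c M q S' + snake c q (Suc s) \<le> sweep c M q (insert s (S' - {Suc s})) + snake c q s"
            using step.prems 3 cq False by (intro step.IH) (auto simp: S'_def r)
          also have "insert s (S' - {Suc s}) = insert q (S2 - {r})"
            using 3 False step.prems by (auto simp: S'_def S2_def r)
          finally have "sweep c M q S' + snake c r (Suc s) \<le> sweep c M q (insert q (S2 - {r})) + snake c r s"
            unfolding eqs .
          moreover have "q \<notin> S2" using False 3 by (simp add: S2_def)
          moreover have "sweep c M r S = wt c r + max (sweep c M q S) (sweep c M q S')"
            using rS False by (simp add: step_eq S'_def)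
          moreover have "sweep c M r S2 = wt c r + max (sweep c M q S2) (sweep c M q (insert q (S2 - {r})))"
            using rS mem calculation(2) by (simp add: step_eq)
          ultimately show ?thesis using IH unfolding eqs by linarith
        qed
      qed
    qed
  qed
  then show ?case by (simp only: S2_def r)
qed

text \<open>
  The topmost path either runs up column \<open>c\<close> to the diagonal, collecting \<open>e c t\<close>, or turns right at a row \<open>u > c\<close>.
  In the latter case it contributes at most \<open>e (c + 1) u\<close> after the weights of the rows from \<open>u\<close> to \<open>t\<close> in column \<open>c\<close>, and
  \<open>e (c + 1) u \<le> e c (u - 1)\<close> shows that this is not better.
\<close>

lemma sweep_drop_first:
  assumes D: "drop_first (Suc c) (e (Suc c)) M"
    and "c \<le> r" "r < n" "c \<le> t" "t < n" "U \<subseteq> {t<..}"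
  shows "sweep c M r (insert t U) \<le> sweep c M r U + (if t \<le> r then e c t else e (Suc c) t)"
  using assms(2-)
proof (induction r arbitrary: t U rule: dec_induct)
  case base
  show ?case
  proof (cases "t = c")
    case True
    then have "c \<notin> U" "insert c U - {c} = U" using base by auto
    with True show ?thesis by (simp add: sweep_diag wt_def)
  next
    case False
    then have "c \<notin> U" "c \<noteq> t" "Suc c \<le> t" using base by auto
    with D base show ?thesis by (simp add: sweep_diag drop_first_def)
  qed
next
  case (step q)
  define r where r: "r = Suc q"
  note cq = \<open>c \<le> q\<close>
  note step_eq = sweep_Suc[OF cq, of M, folded r]
  have IH: "sweep c M q (insert t U) \<le> sweep c M q U + (if t \<le> q then e c t else e (Suc c) t)"
    using step.prems by (intro step.IH) auto
  have rn: "r < n" using step.prems by (simp add: r)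
  consider "t = r" | "t < r" | "t > r" by linarith
  then have "sweep c M r (insert t U) \<le> sweep c M r U + (if t \<le> r then e c t else e (Suc c) t)"
  proof cases
    case 1
    have U: "r \<notin> U" "q \<notin> U" using step.prems 1 by (auto simp: r)
    have "sweep c M q (insert q U) \<le> sweep c M q U + (if q \<le> q then e c q else e (Suc c) q)"
      using step.prems cq 1 by (intro step.IH) (auto simp: r)
    moreover have "insert q (insert r U - {r}) = insert q U" using U by auto
    moreover have "e (Suc c) r \<le> e c q" using e_diag[OF cq] rn by (simp add: r)
    moreover have "wt c r = e c r - e c q" using cq by (simp add: wt_def r)
    moreover have "q \<noteq> r" by (simp add: r)
    ultimately show ?thesis using IH 1 U by (simp add: step_eq r[symmetric] max_def) (use r in auto)
  next
    case 2
    then have tq: "t \<le> q" by (simp add: r)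
    show ?thesis
    proof (cases "r \<in> U")
      case False
      with 2 IH tq show ?thesis by (simp add: step_eq)
    next
      case rU: True
      define U' where "U' = insert q (U - {r})"
      have *: "sweep c M q (insert q (insert t U - {r})) \<le> sweep c M q U' + e c t" if "q \<noteq> t"
      proof -
        have "insert q (insert t U - {r}) = insert t U'" using 2 by (auto simp: U'_def)
        then show ?thesis
          using step.IH[of t U'] step.prems tq that by (auto simp: U'_def)
      qed
      show ?thesis
        using rU 2 IH tq * by (auto simp: step_eq U'_def max_def)
    qed
  next
    case 3
    then have "r \<notin> U" using step.prems by auto
    with 3 have "sweep c M r (insert t U) = sweep c M q (insert t U)" "sweep c M r U = sweep c M q U"
      by (simp_all add: step_eq)
    with 3 IH show ?thesis by (simp add: r)
  qed
  then show ?case by (simp only: r)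
qed

primrec lev :: "nat \<Rightarrow> nat set \<Rightarrow> rat" where
  "lev 0 = (\<lambda>S. 0)"
| "lev (Suc d) = sweep (n - Suc d) (lev d) (n - 1)"

text \<open>
  The largest weight of a family of disjoint paths that enter column \<open>c\<close> in the rows \<open>S\<close>.
\<close>

definition best :: "nat \<Rightarrow> nat set \<Rightarrow> rat" where
  "best c = lev (n - c)"

lemma best_n: "best n = (\<lambda>S. 0)"
  by (simp add: best_def)

lemma best_sweep: "c < n \<Longrightarrow> best c = sweep c (best (Suc c)) (n - 1)"
  using lev.simps(2)[of "n - Suc c"] by (simp add: best_def Suc_diff_Suc del: lev.simps)

lemma best_shifts:
  assumes "c \<le> n"
  shows "shift_up c (best c) \<and> shift_down c (\<alpha> c) (best c) \<and> drop_first c (e c) (best c)"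
  using assms
proof (induction c rule: inc_induct)
  case base
  then show ?case by (simp add: shift_up_def shift_down_def drop_first_def)
next
  case (step c)
  then have IH: "shift_up (Suc c) (best (Suc c))" "shift_down (Suc c) (\<alpha> (Suc c)) (best (Suc c))"
    "drop_first (Suc c) (e (Suc c)) (best (Suc c))" and cn: "c \<le> n - 1" "n - 1 < n" by auto
  have "shift_up c (best c)"
    unfolding shift_up_def best_sweep[OF step(2)]
    using sweep_shift_up[OF IH(1) cn] by auto
  moreover have "shift_down c (\<alpha> c) (best c)"
    unfolding shift_down_def best_sweep[OF step(2)]
  proof (intro allI impI, goal_cases)
    case (1 S s)
    then have "s \<le> n - 1" "Suc s \<le> n - 1" by auto
    then show ?case
      using sweep_shift_down[OF IH(2,3) cn, of s S] 1 by simp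
  qed
  moreover have "drop_first c (e c) (best c)"
    unfolding drop_first_def best_sweep[OF step(2)]
  proof (intro allI impI, goal_cases)
    case (1 t U)
    then have "t \<le> n - 1" by auto
    then show ?case
      using sweep_drop_first[OF IH(3) cn, of t U] 1 by simp
  qed
  ultimately show ?case by blast
qed

text \<open>
  Every row of the interval but the first lies directly below another starting row, so that its path
  can only turn right and collects the weight of one vertex of column \<open>c\<close>. The first path contributes at
  most \<open>e c p\<close> by \<open>drop_first\<close>, and these weights add up to \<open>e c (q - 1)\<close>.
\<close>

lemma best_interval_step:
  assumes "c \<le> p" "p < q" "q \<le> n"
  shows "best c {p..<q} \<le> e c (q - 1) + best (Suc c) {Suc p..<q}"
proof -
  have cn: "c < n" "n - 1 < n" "c \<le> n - 1" using assms by auto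
  let ?M = "best (Suc c)"
  have D: "drop_first (Suc c) (e (Suc c)) ?M" using best_shifts[of "Suc c"] cn by simp
  have *: "sweep c ?M r {p..<q} \<le> e c (min r (q - 1)) + ?M {Suc p..<q}" if "p \<le> r" "r < n" for r
    using that
  proof (induction r rule: dec_induct)
    case base
    have "{p..<q} = insert p {Suc p..<q}" using assms by auto
    moreover have "sweep c ?M p (insert p {Suc p..<q}) \<le> sweep c ?M p {Suc p..<q} + e c p"
    proof -
      have "{Suc p..<q} \<subseteq> {p<..}" by auto
      then show ?thesis
        using sweep_drop_first[OF D, of p p "{Suc p..<q}"] assms by simp
    qed
    moreover have "sweep c ?M p {Suc p..<q} = ?M {Suc p..<q}"
      using assms by (intro sweep_above) auto
    moreover have "min p (q - 1) = p" using assms by auto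
    ultimately show ?case by simp
  next
    case (step r)
    then have cr: "c \<le> r" using assms by simp
    show ?case
    proof (cases "Suc r < q")
      case True
      then have "sweep c ?M (Suc r) {p..<q} = wt c (Suc r) + sweep c ?M r {p..<q}"
        using step by (simp add: sweep_Suc[OF cr])
      moreover have "min (Suc r) (q - 1) = Suc r" "min r (q - 1) = r" using True by auto
      moreover have "wt c (Suc r) = e c (Suc r) - e c r" using cr by (simp add: wt_def)
      ultimately show ?thesis using step by simp
    next
      case False
      then have "sweep c ?M (Suc r) {p..<q} = sweep c ?M r {p..<q}" by (simp add: sweep_Suc[OF cr])
      moreover have "min (Suc r) (q - 1) = min r (q - 1)" using False by auto
      ultimately show ?thesis using step by simp
    qed
  qed
  show ?thesis
    unfolding best_sweep[OF cn(1)] using *[of "n - 1"] assms by (simp add: min_absorb2)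
qed

lemma best_interval:
  assumes "p + k \<le> n" "c \<le> p"
  shows "best c {p..<p + k} \<le> (\<Sum>b<k. e (c + b) (p + k - 1))"
  using assms
proof (induction k arbitrary: c p)
  case 0
  have "best c {} \<le> 0" if "c \<le> n" for c using that
  proof (induction c rule: inc_induct)
    case base then show ?case by (simp add: best_n)
  next
    case (step c)
    have "sweep c (best (Suc c)) (n - 1) {} = best (Suc c) {}"
      using step by (intro sweep_above) auto
    with step show ?case by (simp add: best_sweep)
  qed
  with 0 show ?case by simp
next
  case (Suc k)
  have "best c {p..<p + Suc k} \<le> e c (p + k) + best (Suc c) {Suc p..<Suc p + k}"
    using best_interval_step[of c p "p + Suc k"] Suc.prems by simp
  also have "\<dots> \<le> e c (p + k) + (\<Sum>b<k. e (Suc c + b) (Suc p + k - 1))"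
    using Suc.IH[of "Suc p" "Suc c"] Suc.prems by simp
  also have "\<dots> = (\<Sum>b<Suc k. e (c + b) (p + Suc k - 1))"
    by (simp only: sum.lessThan_Suc_shift) simp
  finally show ?case .
qed


lemma \<alpha>_antimono: "c \<le> r \<Longrightarrow> Suc r < n \<Longrightarrow> \<alpha> c (Suc r) \<le> \<alpha> c r"
  using \<alpha>_up[of c r] \<alpha>_down[of c r] by simp

text \<open>
  Adjacent rows that are out of the order \<open>I, S, J\<close> (with \<open>I\<close> the complement of \<open>S \<union> J\<close>) are exchanged without
  loss: \<open>shift_up\<close> serves \<open>S, I\<close>, monotonicity of \<open>\<alpha> 0\<close> serves \<open>J, I\<close>, and \<open>shift_down\<close> serves \<open>J, S\<close>.
  Each exchange moves weight to higher row numbers, as measured by \<open>\<mu>\<close>, so the sorting terminates.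
\<close>

lemma best_le_sorted:
  assumes "S \<inter> J = {}" "S \<union> J \<subseteq> {..<n}" "card S = k" "card J = j" "i + j + k = n"
  shows "best 0 S - (\<Sum>r\<in>J. \<alpha> 0 r) \<le> (\<Sum>b<k. e b (i + k - 1)) - (\<Sum>r\<in>{i + k..<n}. \<alpha> 0 r)"
proof -
  \<comment> \<open>The factor 2 orders \<open>I\<close>, \<open>S\<close>, \<open>J\<close> by the weights 0, 1, 2, so that every exchange increases \<open>\<mu>\<close>.\<close>
  define \<mu> :: "nat set \<times> nat set \<Rightarrow> int" where
    "\<mu> = (\<lambda>(S, J). (\<Sum>r\<in>S. int r) + 2 * (\<Sum>r\<in>J. int r))"
  define N where "N = 3 * (\<Sum>r<n. int r)"
  have up: "shift_up 0 (best 0)" and down: "shift_down 0 (\<alpha> 0) (best 0)"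
    using best_shifts[of 0] by auto
  have bound: "\<mu> (S, J) \<le> N" if "S \<subseteq> {..<n}" "J \<subseteq> {..<n}" for S J
    using sum_mono2[of "{..<n}" S int] sum_mono2[of "{..<n}" J int] that
    by (simp add: \<mu>_def N_def)
  define P where "P S J \<longleftrightarrow> S \<inter> J = {} \<and> S \<union> J \<subseteq> {..<n} \<and> card S = k \<and> card J = j" for S J
  define V where "V S J = best 0 S - (\<Sum>r\<in>J. \<alpha> 0 r)" for S J
  have "P S J \<Longrightarrow> V S J \<le> (\<Sum>b<k. e b (i + k - 1)) - (\<Sum>r\<in>{i + k..<n}. \<alpha> 0 r)" for S J
  proof (induction "nat (N - \<mu> (S, J))" arbitrary: S J rule: less_induct)
    case less
    then have fin: "finite S" "finite J" and sub: "S \<subseteq> {..<n}" "J \<subseteq> {..<n}"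
      and dj: "S \<inter> J = {}" and cd: "card S = k" "card J = j"
      by (auto simp: P_def intro: finite_subset)
    have improve: ?case if "P S' J'" "\<mu> (S, J) < \<mu> (S', J')" "V S J \<le> V S' J'" for S' J'
    proof -
      have "nat (N - \<mu> (S', J')) < nat (N - \<mu> (S, J))"
        using that bound[of S' J'] by (auto simp: P_def)
      from less.hyps[OF this that(1)] that(3) show ?thesis by simp
    qed
    have moved: "card (insert x (A - {y})) = card A" if "y \<in> A" "x \<notin> A" "finite A" for x y and A :: "nat set"
      using that card.remove[of A y] by simp
    show ?case
    proof (cases "\<exists>s. Suc s < n \<and> s \<in> S \<and> Suc s \<notin> S \<union> J")
      case True
      then obtain s where s: "Suc s < n" "s \<in> S" "Suc s \<notin> S \<union> J" by blast
      show ?thesis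
      proof (rule improve[of "insert (Suc s) (S - {s})" J])
        show "P (insert (Suc s) (S - {s})) J"
          using s sub dj cd fin by (auto simp: P_def moved simp del: card_insert_disjoint)
        show "\<mu> (S, J) < \<mu> (insert (Suc s) (S - {s}), J)"
          using s fin by (simp only: \<mu>_def prod.case) (simp add: swap_up_sums del: sum.insert)
        show "V S J \<le> V (insert (Suc s) (S - {s})) J"
          using up s by (simp add: V_def shift_up_def)
      qed
    next
      case noA: False
      show ?thesis
      proof (cases "\<exists>s. Suc s < n \<and> s \<in> J \<and> Suc s \<notin> S \<union> J")
        case True
        then obtain s where s: "Suc s < n" "s \<in> J" "Suc s \<notin> S \<union> J" by blast
        show ?thesis
        proof (rule improve[of S "insert (Suc s) (J - {s})"])
          show "P S (insert (Suc s) (J - {s}))"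
            using s sub dj cd fin by (auto simp: P_def moved simp del: card_insert_disjoint)
          show "\<mu> (S, J) < \<mu> (S, insert (Suc s) (J - {s}))"
            using s fin by (simp only: \<mu>_def prod.case) (simp add: swap_up_sums del: sum.insert)
          show "V S J \<le> V S (insert (Suc s) (J - {s}))"
            using s fin \<alpha>_antimono[of 0 s] by (simp add: V_def swap_up_sums del: sum.insert)
        qed
      next
        case noB: False
        show ?thesis
        proof (cases "\<exists>s. Suc s < n \<and> s \<in> J \<and> Suc s \<in> S")
          case True
          then obtain s where s: "Suc s < n" "s \<in> J" "Suc s \<in> S" by blast
          with dj have s': "s \<notin> S" "Suc s \<notin> J" by auto
          show ?thesis
          proof (rule improve[of "insert s (S - {Suc s})" "insert (Suc s) (J - {s})"])
            show "P (insert s (S - {Suc s})) (insert (Suc s) (J - {s}))"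
              using s s' sub dj cd fin by (auto simp: P_def moved simp del: card_insert_disjoint)
            show "\<mu> (S, J) < \<mu> (insert s (S - {Suc s}), insert (Suc s) (J - {s}))"
              using s s' fin by (simp only: \<mu>_def prod.case)
                (simp add: swap_up_sums swap_down_sums del: sum.insert)
            show "V S J \<le> V (insert s (S - {Suc s})) (insert (Suc s) (J - {s}))"
              using s s' fin down[unfolded shift_down_def, rule_format, of s S]
              by (simp add: V_def swap_up_sums del: sum.insert)
          qed
        next
          case noC: False
          have "J = {n - card J..<n}"
            using noB noC sub by (intro up_closed_eq_interval) auto
          also have "n - card J = i + k" using cd assms(5) by linarith
          finally have J: "J = {i + k..<n}" .
          have "S \<union> J = {n - card (S \<union> J)..<n}"
            using noA noB sub by (intro up_closed_eq_interval) auto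
          also have "card (S \<union> J) = k + j"
            using fin dj cd by (simp add: card_Un_disjoint)
          also have "n - (k + j) = i" using assms(5) by linarith
          finally have "S \<union> J = {i..<n}" .
          then have "S = {i..<n} - J" using dj by auto
          then have S: "S = {i..<i + k}" using J assms(5) by auto
          show ?thesis
            using best_interval[of i k 0] assms(5) unfolding V_def S J by simp
        qed
      qed
    qed
  qed
  then show ?thesis using assms by (simp add: P_def V_def)
qed

end

section \<open>The path matrix\<close>

context path_weights
begin

text \<open>
  Row \<open>c\<close> of the path matrix when entered at column \<open>c\<close>: the only path ends at once, at the sink \<open>c\<close>.
\<close>

definition base_rows :: "nat \<Rightarrow> (nat \<Rightarrow> nat \<Rightarrow> puiseux) \<Rightarrow> nat \<Rightarrow> nat \<Rightarrow> puiseux" where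
  "base_rows c W = W(c := (\<lambda>b. if b = c then tpow (wt c c) else 0))"

text \<open>
  Generating functions of single paths, in step with \<open>sweep\<close>: the rows \<open>> r\<close> are entered at column \<open>c + 1\<close>,
  with path matrix \<open>W\<close>, and the rows \<open>\<le> r\<close> at column \<open>c\<close>.
\<close>

primrec rows :: "nat \<Rightarrow> (nat \<Rightarrow> nat \<Rightarrow> puiseux) \<Rightarrow> nat \<Rightarrow> nat \<Rightarrow> nat \<Rightarrow> puiseux" where
  "rows c W 0 = base_rows c W"
| "rows c W (Suc r) =
     (if Suc r \<le> c then base_rows c W
      else (rows c W r)(Suc r := (\<lambda>b. tpow (wt c (Suc r)) * (rows c W r (Suc r) b + rows c W r r b))))"

declare rows.simps(2) [simp del]

lemma rows_diag: "rows c W c = base_rows c W"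
  by (cases c) (auto simp: rows.simps(2))

lemma rows_Suc:
  "c \<le> r \<Longrightarrow> rows c W (Suc r) =
     (rows c W r)(Suc r := (\<lambda>b. tpow (wt c (Suc r)) * (rows c W r (Suc r) b + rows c W r r b)))"
  by (simp add: rows.simps(2))

lemma rows_above: "c \<le> r \<Longrightarrow> r < a \<Longrightarrow> rows c W r a = W a"
  by (induction r rule: dec_induct) (auto simp: rows_diag base_rows_def rows_Suc)

lemma rows_real:
  assumes "\<And>a b. W a b \<in> real_puiseux" "c \<le> r"
  shows "rows c W r a b \<in> real_puiseux"
  using assms(2)
  by (induction r arbitrary: a b rule: dec_induct)
     (auto simp: rows_diag base_rows_def rows_Suc assms(1) intro!: real_mult real_add)

lemma minor_rows_Suc:
  assumes "c \<le> r" "finite S" "Suc r \<in> S"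
  shows "leib S (\<lambda>a b. rows c W (Suc r) a (f b)) = tpow (wt c (Suc r)) *
    (leib S (\<lambda>a b. rows c W r a (f b)) + leib S (\<lambda>a b. ((rows c W r)(Suc r := rows c W r r)) a (f b)))"
proof -
  define A where "A = (\<lambda>a b. rows c W r a (f b))"
  have "(\<lambda>a b. rows c W (Suc r) a (f b)) = A(Suc r := (\<lambda>b. tpow (wt c (Suc r)) * (A (Suc r) b + A r b)))"
    using assms(1) by (auto simp: A_def rows_Suc fun_eq_iff)
  moreover have "(\<lambda>a b. ((rows c W r)(Suc r := rows c W r r)) a (f b)) = A(Suc r := A r)"
    by (auto simp: A_def fun_eq_iff)
  ultimately show ?thesis
    using leib_row_linear[OF assms(2,3), of A _ "A (Suc r)" "A r"] by (simp flip: A_def)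
qed

lemma minor_rows_Suc_same:
  assumes "c \<le> r" "finite S" "Suc r \<in> S" "r \<in> S"
  shows "leib S (\<lambda>a b. rows c W (Suc r) a (f b)) = tpow (wt c (Suc r)) * leib S (\<lambda>a b. rows c W r a (f b))"
proof -
  have "leib S (\<lambda>a b. ((rows c W r)(Suc r := rows c W r r)) a (f b)) = 0"
    by (rule leib_equal_rows[OF assms(2-4)]) auto
  then show ?thesis by (simp add: minor_rows_Suc[OF assms(1-3)])
qed

text \<open>
  The recursion for the rows is mirrored by that for \<open>sweep\<close>: in the sum \<open>row (r + 1) + row r\<close> the second
  summand replaces row \<open>r + 1\<close> by row \<open>r\<close>, and it contributes nothing if row \<open>r\<close> is already present.
\<close>

lemma rows_bound:
  assumes W: "\<And>S f. S \<subseteq> {Suc c..<n} \<Longrightarrow> deg_le (leib S (\<lambda>a b. W a (f b))) (M S)"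
    and "c \<le> r" "r < n" "S \<subseteq> {c..<n}"
  shows "deg_le (leib S (\<lambda>a b. rows c W r a (f b))) (sweep c M r S)"
  using assms(2-)
proof (induction r arbitrary: S f rule: dec_induct)
  case base
  define T where "T = S - {c}"
  have T: "finite T" "c \<notin> T" "T \<subseteq> {Suc c..<n}"
    using base by (auto simp: T_def subset_eq Suc_le_eq nat_less_le intro: finite_subset[of _ "{c..<n}"])
  have eq: "leib T (\<lambda>a d. rows c W c a (g d)) = leib T (\<lambda>a d. W a (g d))" for g
    using T by (intro leib_cong) (auto simp: rows_diag base_rows_def)
  show ?case
  proof (cases "c \<in> S")
    case True
    then have S: "S = insert c T" by (auto simp: T_def)
    have "deg_le (rows c W c c (f b) * leib T (\<lambda>a d. W a (f (Transposition.transpose c b d)))) (wt c c + M T)" for b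
      using W[OF T(3), of "\<lambda>d. f (Transposition.transpose c b d)"]
      by (intro deg_le_mult) (auto simp: rows_diag base_rows_def)
    then have "deg_le (leib S (\<lambda>a b. rows c W c a (f b))) (wt c c + M T)"
      unfolding S leib_expand_row[OF T(1,2)] eq by (intro deg_le_sum deg_le_sign)
    then show ?thesis using True by (simp add: sweep_diag T_def)
  next
    case False
    then have "S = T" by (auto simp: T_def)
    then show ?thesis using False W[OF T(3)] by (simp add: sweep_diag eq)
  qed
next
  case (step r)
  note cr = \<open>c \<le> r\<close>
  have fin: "finite S" using step.prems by (auto intro: finite_subset[of _ "{c..<n}"])
  have IH: "deg_le (leib S (\<lambda>a b. rows c W r a (f b))) (sweep c M r S)"
    using step.prems by (intro step.IH) auto
  show ?case
  proof (cases "Suc r \<in> S")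
    case False
    then have "leib S (\<lambda>a b. rows c W (Suc r) a (f b)) = leib S (\<lambda>a b. rows c W r a (f b))"
      by (intro leib_cong) (auto simp: rows_Suc[OF cr])
    with IH False show ?thesis by (simp add: sweep_Suc[OF cr])
  next
    case True
    show ?thesis
    proof (cases "r \<in> S")
      case rS: True
      then show ?thesis
        using True IH by (simp add: minor_rows_Suc_same[OF cr fin] sweep_Suc[OF cr] deg_le_mult)
    next
      case False
      let ?t = "Transposition.transpose r (Suc r)"
      define S' where "S' = insert r (S - {Suc r})"
      have tS: "?t ` S = S'"
        using True False by (auto simp: S'_def Transposition.transpose_def image_iff split: if_splits)
      have "leib S (\<lambda>a b. ((rows c W r)(Suc r := rows c W r r)) a (f b))
          = leib S (\<lambda>a b. rows c W r (?t a) (f (?t (?t b))))"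
        using False by (intro leib_cong) (auto simp: Transposition.transpose_def)
      also have "\<dots> = leib S' (\<lambda>a b. rows c W r a (f (?t b)))"
        using leib_relabel[OF fin, of "\<lambda>a b. rows c W r a (f (?t b))" r "Suc r"] by (simp add: tS)
      finally have eq: "leib S (\<lambda>a b. ((rows c W r)(Suc r := rows c W r r)) a (f b))
        = leib S' (\<lambda>a b. rows c W r a (f (?t b)))" .
      have IH': "deg_le (leib S' (\<lambda>a b. rows c W r a (f (?t b)))) (sweep c M r S')"
        using step.prems cr by (intro step.IH) (auto simp: S'_def)
      have "deg_le (leib S (\<lambda>a b. rows c W r a (f b)) + leib S' (\<lambda>a b. rows c W r a (f (?t b))))
          (max (sweep c M r S) (sweep c M r S'))"
        by (intro deg_le_add deg_le_mono[OF IH] deg_le_mono[OF IH']) auto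
      then have "deg_le (leib S (\<lambda>a b. rows c W (Suc r) a (f b))) (wt c (Suc r) + max (sweep c M r S) (sweep c M r S'))"
        unfolding minor_rows_Suc[OF cr fin True] eq by (intro deg_le_mult deg_le_tpow)
      then show ?thesis
        using True False by (simp add: sweep_Suc[OF cr] S'_def)
    qed
  qed
qed

lemma rows_first_column:
  assumes "\<And>a. W a c = 0" "c \<le> r"
  shows "rows c W r r c = tpow (e c r)"
  using assms(2)
proof (induction r rule: dec_induct)
  case base
  then show ?case by (simp add: rows_diag base_rows_def wt_def)
next
  case (step r)
  then show ?case
    by (simp add: rows_Suc rows_above assms(1) tpow_mult wt_def)
qed

text \<open>
  The column of sink \<open>c\<close> vanishes in \<open>W\<close>, so that this sink can only be reached by the first path, along
  column \<open>c\<close>; this accounts for \<open>e c p\<close>. In every later row of the interval the summand from the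
  previous row drops out, as that row is present too, and a monomial multiple of the row of \<open>W\<close> remains.
\<close>

lemma rows_interval_minor:
  assumes W: "\<And>a. W a c = 0" and "c \<le> p" "p < q" "q \<le> n" "p \<le> r" "r < n"
    and f: "f p = c"
  shows "leib {p..<q} (\<lambda>a b. rows c W r a (f b)) =
    tpow (e c (min r (q - 1))) * leib {Suc p..<q} (\<lambda>a b. W a (f b))"
  using \<open>p \<le> r\<close> \<open>r < n\<close>
proof (induction r rule: dec_induct)
  case base
  define T where "T = {Suc p..<q}"
  have T: "{p..<q} = insert p T" "finite T" "p \<notin> T" using assms by (auto simp: T_def)
  have above: "rows c W p a = W a" if "a \<in> T" for a
    using that assms by (intro rows_above) (auto simp: T_def)
  have zero: "leib T (\<lambda>a d. rows c W p a (f (Transposition.transpose p b d))) = 0" if "b \<in> T" for b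
    using that T(2) by (intro leib_zero_col[of T b]) (auto simp: above f W)
  have "leib {p..<q} (\<lambda>a b. rows c W p a (f b)) =
    (\<Sum>b\<in>{p}. of_int (sign (Transposition.transpose p b)) * (rows c W p p (f b) * leib T (\<lambda>a d. rows c W p a (f (Transposition.transpose p b d)))))"
    unfolding T(1) leib_expand_row[OF T(2,3)] using T(2) zero by (intro sum.mono_neutral_right) auto
  also have "\<dots> = tpow (e c p) * leib T (\<lambda>a d. rows c W p a (f d))"
    using assms by (simp add: rows_first_column sign_id)
  also have "leib T (\<lambda>a d. rows c W p a (f d)) = leib T (\<lambda>a b. W a (f b))"
    by (intro leib_cong) (simp add: above)
  finally show ?case using assms by (simp add: T_def min_absorb1)
next
  case (step r)
  then have cr: "c \<le> r" using assms by simp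
  show ?case
  proof (cases "Suc r < q")
    case True
    then have "min (Suc r) (q - 1) = Suc r" "min r (q - 1) = r" by auto
    moreover have "tpow (wt c (Suc r)) * (tpow (e c r) * z) = tpow (e c (Suc r)) * z" for z
      using cr by (simp add: wt_def tpow_mult flip: mult.assoc)
    ultimately show ?thesis
      using step True by (simp add: minor_rows_Suc_same[OF cr])
  next
    case False
    then have "leib {p..<q} (\<lambda>a b. rows c W (Suc r) a (f b)) = leib {p..<q} (\<lambda>a b. rows c W r a (f b))"
      by (intro leib_cong) (auto simp: rows_Suc[OF cr])
    moreover have "min (Suc r) (q - 1) = min r (q - 1)" using False by auto
    ultimately show ?thesis using step by simp
  qed
qed

primrec lev_rows :: "nat \<Rightarrow> nat \<Rightarrow> nat \<Rightarrow> puiseux" where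
  "lev_rows 0 = (\<lambda>a b. 0)"
| "lev_rows (Suc d) = rows (n - Suc d) (lev_rows d) (n - 1)"

text \<open>
  The path matrix of the columns \<open>\<ge> c\<close>.
\<close>

definition net :: "nat \<Rightarrow> nat \<Rightarrow> nat \<Rightarrow> puiseux" where
  "net c = lev_rows (n - c)"

lemma net_n: "net n = (\<lambda>a b. 0)"
  by (simp add: net_def)

lemma net_rows: "c < n \<Longrightarrow> net c = rows c (net (Suc c)) (n - 1)"
  using lev_rows.simps(2)[of "n - Suc c"] by (simp add: net_def Suc_diff_Suc del: lev_rows.simps)

lemma net_real: "c \<le> n \<Longrightarrow> net c a b \<in> real_puiseux"
proof (induction c arbitrary: a b rule: inc_induct)
  case (step c)
  then show ?case by (simp add: net_rows rows_real)
qed (simp add: net_n)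

lemma net_minor_deg_le:
  assumes "c \<le> n" "S \<subseteq> {c..<n}"
  shows "deg_le (leib S (\<lambda>a b. net c a (f b))) (best c S)"
  using assms
proof (induction c arbitrary: S f rule: inc_induct)
  case base
  have "deg_le 1 0" using deg_le_tpow[of 0] by (simp add: tpow_0)
  with base show ?case by (simp add: best_n)
next
  case (step c)
  then show ?case
    using rows_bound[of c "net (Suc c)" "best (Suc c)" "n - 1" S f]
    by (simp add: net_rows best_sweep)
qed

lemma net_column_zero: "c \<le> n \<Longrightarrow> b < c \<Longrightarrow> net c a b = 0"
proof (induction c arbitrary: a rule: inc_induct)
  case (step c)
  have "rows c (net (Suc c)) r a b = 0" if "c \<le> r" for r a
    using that
  proof (induction r arbitrary: a rule: dec_induct)
    case base
    with step show ?case by (simp add: rows_diag base_rows_def)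
  next
    case (step r)
    then show ?case by (simp add: rows_Suc)
  qed
  with step show ?case by (simp add: net_rows)
qed (simp add: net_n)

text \<open>
  The first path runs up column \<open>c\<close> to the diagonal, and the remaining ones form the same configuration
  one column and one row further on. The value is a single monomial, which is why the bound of
  \<open>best_le_sorted\<close> is attained.
\<close>

lemma net_interval_minor:
  assumes "p + k \<le> n" "c \<le> p"
  shows "leib {p..<p + k} (\<lambda>a b. net c a (c + (b - p))) = tpow (\<Sum>b<k. e (c + b) (p + k - 1))"
  using assms
proof (induction k arbitrary: c p)
  case 0
  then show ?case by (simp add: tpow_0)
next
  case (Suc k)
  then have cn: "c < n" by simp
  have "leib {p..<p + Suc k} (\<lambda>a b. net c a (c + (b - p)))
      = tpow (e c (min (n - 1) (p + Suc k - 1))) * leib {Suc p..<p + Suc k} (\<lambda>a b. net (Suc c) a (c + (b - p)))"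
    unfolding net_rows[OF cn] using Suc.prems cn
    by (intro rows_interval_minor) (auto simp: net_column_zero)
  also have "min (n - 1) (p + Suc k - 1) = p + k" using Suc.prems by auto
  also have "leib {Suc p..<p + Suc k} (\<lambda>a b. net (Suc c) a (c + (b - p)))
      = leib {Suc p..<Suc p + k} (\<lambda>a b. net (Suc c) a (Suc c + (b - Suc p)))"
    by (simp, intro leib_cong arg_cong2[of _ _ _ _ "net (Suc c)"]) auto
  also have "\<dots> = tpow (\<Sum>b<k. e (Suc c + b) (Suc p + k - 1))"
    using Suc.prems by (intro Suc.IH) auto
  also have "tpow (e c (p + k)) * \<dots> = tpow (\<Sum>b<Suc k. e (c + b) (p + Suc k - 1))"
    unfolding tpow_mult by (simp only: sum.lessThan_Suc_shift) simp
  finally show ?case .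
qed

end

section \<open>Gram matrices\<close>

definition gram :: "nat \<Rightarrow> (nat \<Rightarrow> nat \<Rightarrow> puiseux) \<Rightarrow> puiseux mat" where
  "gram n A = mat n n (\<lambda>(a, b). \<Sum>\<kappa><n. A a \<kappa> * A b \<kappa>)"

definition diag :: "(nat \<Rightarrow> puiseux) \<Rightarrow> nat \<Rightarrow> nat \<Rightarrow> puiseux" where
  "diag d a b = (if a = b then d a else 0)"

lemma leib_diag:
  assumes "finite S"
  shows "leib S (diag d) = (\<Prod>a\<in>S. d a)"
proof -
  have "leib S (diag d) = (\<Sum>p\<in>{id}. of_int (sign p) * (\<Prod>a\<in>S. diag d a (p a)))"
    unfolding leib_def
  proof (rule sum.mono_neutral_right)
    show "finite {p. p permutes S}" by (rule finite_permutations[OF assms])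
    show "{id} \<subseteq> {p. p permutes S}" by (simp add: permutes_id)
    show "\<forall>p\<in>{p. p permutes S} - {id}. of_int (sign p) * (\<Prod>a\<in>S. diag d a (p a)) = 0"
    proof
      fix p assume "p \<in> {p. p permutes S} - {id}"
      then have "\<exists>a\<in>S. diag d a (p a) = 0"
        by (auto simp: diag_def fun_eq_iff) (metis permutes_not_in)
      then show "of_int (sign p) * (\<Prod>a\<in>S. diag d a (p a)) = 0"
        using assms by (simp add: prod_zero)
    qed
  qed
  then show ?thesis by (simp add: diag_def sign_id)
qed

lemma diag_gram_entry:
  assumes "a < n" "b < n"
  shows "(\<Sum>\<kappa><n. diag d a \<kappa> * diag d b \<kappa>) = (if a = b then d a * d a else 0)"
proof -
  have "(\<Sum>\<kappa><n. diag d a \<kappa> * diag d b \<kappa>) = (\<Sum>\<kappa>\<in>{a}. diag d a \<kappa> * diag d b \<kappa>)"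
    using assms by (intro sum.mono_neutral_right) (auto simp: diag_def)
  then show ?thesis by (auto simp: diag_def)
qed

lemma gram_diag: "gram n (diag d) = mat n n (\<lambda>(a, b). if a = b then d a * d a else 0)"
  unfolding gram_def by (intro eq_matI) (auto simp: diag_gram_entry)

lemma conjugate_sum: "conjugate (sum f A) = (\<Sum>x\<in>A. conjugate (f x :: puiseux))"
  by (induction A rule: infinite_finite_induct) (auto simp: conjugate_dist_add)

lemma pos_def_gram:
  assumes real: "\<And>a b. A a b \<in> real_puiseux" and det: "leib {0..<n} A \<noteq> 0"
  shows "pos_def_hermitian n (gram n A)"
  unfolding pos_def_hermitian_def
proof (intro conjI ballI impI)
  have cA: "conjugate (A a b) = A a b" for a b
    using real by (simp add: real_puiseux_iff)
  show "hermitian n (gram n A)"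
    by (auto simp: hermitian_def gram_def conjugate_sum conjugate_dist_mul cA mult.commute)
  fix v :: "puiseux Matrix.vec"
  assume v: "v \<in> carrier_vec n" "v \<noteq> 0\<^sub>v n"
  define w where "w \<kappa> = (\<Sum>a<n. A a \<kappa> * v $ a)" for \<kappa>
  have "\<exists>\<kappa>\<in>{..<n}. w \<kappa> \<noteq> 0"
  proof (rule ccontr)
    assume no: "\<not> (\<exists>\<kappa>\<in>{..<n}. w \<kappa> \<noteq> 0)"
    define B where "B = mat n n (\<lambda>(a, b). A b a)"
    have B: "B \<in> carrier_mat n n" by (simp add: B_def)
    have "B *\<^sub>v v = 0\<^sub>v n"
    proof (rule eq_vecI)
      fix i assume "i < dim_vec (0\<^sub>v n :: puiseux Matrix.vec)"
      then show "(B *\<^sub>v v) $ i = 0\<^sub>v n $ i"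
        using no v by (simp add: B_def w_def scalar_prod_def lessThan_atLeast0)
    qed (simp add: B_def)
    with v B have "Determinant.det B = 0" using det_0_iff_vec_prod_zero_field[OF B] by blast
    then show False using det unfolding B_def det_eq_leib by (simp add: leib_transpose[of _ A])
  qed
  then have "(\<Sum>\<kappa><n. w \<kappa> * conjugate (w \<kappa>)) \<in> pos_puiseux"
    by (intro pos_puiseux_norm_sum) auto
  also have "(\<Sum>\<kappa><n. w \<kappa> * conjugate (w \<kappa>)) = (gram n A *\<^sub>v v) \<bullet>c v"
  proof -
    have "(\<Sum>\<kappa><n. w \<kappa> * conjugate (w \<kappa>)) = (\<Sum>\<kappa><n. \<Sum>b<n. \<Sum>a<n. A b \<kappa> * v $ b * (A a \<kappa> * conjugate (v $ a)))"
      by (simp add: w_def conjugate_sum conjugate_dist_mul cA sum_product)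
    also have "\<dots> = (\<Sum>b<n. \<Sum>\<kappa><n. \<Sum>a<n. A b \<kappa> * v $ b * (A a \<kappa> * conjugate (v $ a)))"
      by (rule sum.swap)
    also have "\<dots> = (\<Sum>b<n. \<Sum>a<n. \<Sum>\<kappa><n. A b \<kappa> * v $ b * (A a \<kappa> * conjugate (v $ a)))"
      by (intro sum.cong refl sum.swap)
    also have "\<dots> = (\<Sum>a<n. \<Sum>b<n. \<Sum>\<kappa><n. A b \<kappa> * v $ b * (A a \<kappa> * conjugate (v $ a)))"
      by (rule sum.swap)
    also have "\<dots> = (\<Sum>a<n. (\<Sum>b<n. (\<Sum>\<kappa><n. A a \<kappa> * A b \<kappa>) * v $ b) * conjugate (v $ a))"
      unfolding sum_distrib_right by (intro sum.cong refl) (simp add: mult_ac)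
    also have "\<dots> = (gram n A *\<^sub>v v) \<bullet>c v"
      using v by (simp add: gram_def scalar_prod_def lessThan_atLeast0)
    finally show ?thesis .
  qed
  finally show "(gram n A *\<^sub>v v) \<bullet>c v \<in> pos_puiseux" .
qed

text \<open>
  All summands in \<open>leib_gram\<close> are squares of real series, so their coefficients at the highest possible
  exponent add up without cancellation.
\<close>

lemma minor_gram_top:
  fixes R :: "nat \<Rightarrow> nat \<Rightarrow> puiseux"
  assumes "finite S" and real: "\<And>a b. R a b \<in> real_puiseux"
    and le: "\<And>f. deg_le (leib S (\<lambda>a b. R a (f b))) m"
  shows "nonneg_top (leib S (\<lambda>a b. \<Sum>\<kappa><n. R a \<kappa> * R b \<kappa>)) (m + m)"
    and "f \<in> S \<rightarrow> {..<n} \<Longrightarrow> leib S (\<lambda>a b. R a (f b)) = tpow m \<Longrightarrow>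
      Re (pcoeff (leib S (\<lambda>a b. \<Sum>\<kappa><n. R a \<kappa> * R b \<kappa>)) (m + m)) > 0"
proof -
  define G where "G = leib S (\<lambda>a b. \<Sum>\<kappa><n. R a \<kappa> * R b \<kappa>)"
  define L where "L f = leib S (\<lambda>a b. R a (f b))" for f
  have gram: "of_nat (fact (card S)) * G = (\<Sum>f\<in>S \<rightarrow>\<^sub>E {..<n}. L f * L f)"
    using leib_gram[OF assms(1), of "{..<n}" R] by (simp add: G_def L_def power2_eq_square)
  have sq: "nonneg_top (L f * L f) (m + m)" for f
    using le real by (intro nonneg_top_square) (auto simp: L_def intro: real_leib)
  have "nonneg_top (of_nat (fact (card S)) * G) (m + m)"
    unfolding gram by (intro nonneg_top_sum sq)
  then show "nonneg_top G (m + m)"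
    by (rule nonneg_top_div_nat) simp
  assume f: "f \<in> S \<rightarrow> {..<n}" "leib S (\<lambda>a b. R a (f b)) = tpow m"
  define f' where "f' = restrict f S"
  have f': "f' \<in> S \<rightarrow>\<^sub>E {..<n}" using f by (auto simp: f'_def)
  have "L f' = tpow m" unfolding f(2)[symmetric] L_def by (intro leib_cong) (auto simp: f'_def)
  have fin: "finite (S \<rightarrow>\<^sub>E {..<n})" using assms(1) by (intro finite_PiE) auto
  have "of_nat (fact (card S)) * G = L f' * L f' + (\<Sum>f\<in>(S \<rightarrow>\<^sub>E {..<n}) - {f'}. L f * L f)"
    unfolding gram by (rule sum.remove[OF fin f'])
  moreover have "nonneg_top (\<Sum>f\<in>(S \<rightarrow>\<^sub>E {..<n}) - {f'}. L f * L f) (m + m)"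
    by (intro nonneg_top_sum sq)
  ultimately have "Re (pcoeff (of_nat (fact (card S)) * G) (m + m)) > 0"
    by (simp add: \<open>L f' = tpow m\<close> pcoeff_add tpow_mult tpow.rep_eq nonneg_top_def)
  then show "Re (pcoeff G (m + m)) > 0"
    unfolding pcoeff_of_nat_mult by (simp add: zero_less_mult_iff)
qed

section \<open>Expansion of the pencil determinant\<close>

definition const3 :: "puiseux \<Rightarrow> puiseux_poly3" where "const3 = Poly_Mapping.single 0"

lemma const3_mult: "const3 (a * b) = const3 a * const3 b"
  by (simp add: const3_def mult_single)

lemma const3_1: "const3 1 = 1" by (simp add: const3_def)

lemma const3_add: "const3 (a + b) = const3 a + const3 b"
  by (simp add: const3_def single_add)

lemma const3_0: "const3 0 = 0" by (simp add: const3_def)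

lemma const3_uminus: "const3 (- a) = - const3 a"
  by (simp add: const3_def single_uminus)

lemma const3_sum: "const3 (sum f A) = (\<Sum>x\<in>A. const3 (f x))"
  by (induction A rule: infinite_finite_induct) (auto simp: const3_add const3_0)

lemma const3_prod: "const3 (prod f A) = (\<Prod>x\<in>A. const3 (f x))"
  by (induction A rule: infinite_finite_induct) (auto simp: const3_mult const3_1)

lemma const3_power: "const3 (a ^ k) = const3 a ^ k"
  by (induction k) (auto simp: const3_mult const3_1)

lemma const3_leib: "leib S (\<lambda>a b. const3 (N a b)) = const3 (leib S N)"
proof -
  have "const3 (of_int (sign p) * z) = of_int (sign p) * const3 z" for p :: "'a \<Rightarrow> 'a" and z
    by (auto simp: sign_def const3_uminus)
  then show ?thesis unfolding leib_def by (simp add: const3_sum const3_prod)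
qed

lemma single_power_1: "Poly_Mapping.single (i, j, k) (1 :: puiseux) ^ m = Poly_Mapping.single (m * i, m * j, m * k) 1"
  by (induction m) (auto simp: mult_single simp flip: zero_prod_def)

text \<open>
  In each row the determinant is expanded twice: into the part from the third matrix (rows \<open>S\<close>) and
  the diagonal part, and the latter into the second (rows \<open>J\<close>) and the first matrix. The common factor \<open>s\<close>
  adjusts all coefficients by the same power of \<open>t\<close>.
\<close>

lemma det_pencil_expand:
  fixes q :: "nat \<Rightarrow> puiseux" and R :: "nat \<Rightarrow> nat \<Rightarrow> puiseux" and s :: puiseux
  shows "Determinant.det (pencil (gram n (diag (\<lambda>a. s))) (gram n (diag (\<lambda>a. s * q a))) (gram n (\<lambda>a b. s * R a b))) =
    (\<Sum>(S, J)\<in>Sigma (Pow {0..<n}) (\<lambda>S. Pow ({0..<n} - S)).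
       Poly_Mapping.single (n - card S - card J, card J, card S)
         ((s * s) ^ n * ((\<Prod>a\<in>J. q a * q a) * leib S (\<lambda>a b. \<Sum>\<kappa><n. R a \<kappa> * R b \<kappa>))))"
proof -
  define N where "N a b = (\<Sum>\<kappa><n. R a \<kappa> * R b \<kappa>)" for a b
  define x y z :: puiseux_poly3 where
    "x = Poly_Mapping.single (1, 0, 0) 1" and "y = Poly_Mapping.single (0, 1, 0) 1" and
    "z = Poly_Mapping.single (0, 0, 1) 1"
  define A where "A = {0..<n}"
  have A: "finite A" "card A = n" by (auto simp: A_def)
  define B where "B a b = z * const3 (N a b) + (if a = b then y * const3 (q a * q a) + x else 0)" for a b
  have xyz: "Poly_Mapping.single (1, 0, 0) c = x * const3 c" "Poly_Mapping.single (0, 1, 0) c = y * const3 c"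
    "Poly_Mapping.single (0, 0, 1) c = z * const3 c" for c
    by (auto simp: x_def y_def z_def const3_def mult_single simp flip: zero_prod_def)
  have pencil: "pencil (gram n (diag (\<lambda>a. s))) (gram n (diag (\<lambda>a. s * q a))) (gram n (\<lambda>a b. s * R a b))
      = mat n n (\<lambda>(a, b). const3 (s * s) * B a b)"
  proof (rule eq_matI)
    fix a b assume "a < dim_row (mat n n (\<lambda>(a, b). const3 (s * s) * B a b))"
      "b < dim_col (mat n n (\<lambda>(a, b). const3 (s * s) * B a b))"
    then have ab: "a < n" "b < n" by auto
    have "(\<Sum>\<kappa><n. s * R a \<kappa> * (s * R b \<kappa>)) = s * s * N a b"
      by (simp add: N_def sum_distrib_left mult_ac)
    then show "pencil (gram n (diag (\<lambda>a. s))) (gram n (diag (\<lambda>a. s * q a))) (gram n (\<lambda>a b. s * R a b)) $$ (a, b)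
      = mat n n (\<lambda>(a, b). const3 (s * s) * B a b) $$ (a, b)"
      using ab unfolding pencil_def gram_diag
      by (simp add: gram_def xyz B_def const3_mult const3_0 algebra_simps del: One_nat_def)
  qed (auto simp: pencil_def gram_def)
  have prodJ: "(\<Prod>a\<in>A - S. y * const3 (q a * q a) + x) =
      (\<Sum>J\<in>Pow (A - S). y ^ card J * const3 (\<Prod>a\<in>J. q a * q a) * x ^ (n - card S - card J))" if S: "S \<in> Pow A" for S
  proof -
    have "card (A - S - J) = n - card S - card J" if "J \<in> Pow (A - S)" for J
    proof -
      have fin: "finite S" "finite J"
        using that S by (auto intro: finite_subset[OF _ A(1)])
      then show ?thesis using that S A by (simp add: card_Diff_subset)
    qed
    note card_rest = this
    have "(\<Prod>a\<in>A - S. y * const3 (q a * q a) + x) =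
        (\<Sum>J\<in>Pow (A - S). (\<Prod>a\<in>J. y * const3 (q a * q a)) * (\<Prod>a\<in>A - S - J. x))"
      using A by (intro prod_add) simp
    also have "\<dots> = (\<Sum>J\<in>Pow (A - S). y ^ card J * const3 (\<Prod>a\<in>J. q a * q a) * x ^ (n - card S - card J))"
      by (intro sum.cong refl) (simp only: prod.distrib[of "\<lambda>_. y"] prod_constant const3_prod card_rest)
    finally show ?thesis .
  qed
  have mono: "z ^ k * (y ^ j * x ^ i) * const3 c = Poly_Mapping.single (i, j, k) c" for i j k c
    by (simp add: x_def y_def z_def const3_def single_power_1 mult_single)
  define T where "T = Sigma (Pow A) (\<lambda>S. Pow (A - S))"
  have "leib A B = (\<Sum>S\<in>Pow A. (\<Prod>a\<in>A - S. y * const3 (q a * q a) + x) * leib S (\<lambda>a b. z * const3 (N a b)))"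
    unfolding B_def by (rule leib_diag_add[OF A(1)])
  also have "\<dots> = (\<Sum>S\<in>Pow A. \<Sum>J\<in>Pow (A - S).
      (y ^ card J * const3 (\<Prod>a\<in>J. q a * q a) * x ^ (n - card S - card J)) * (z ^ card S * const3 (leib S N)))"
  proof (intro sum.cong refl)
    fix S assume S: "S \<in> Pow A"
    then have "finite S" using A finite_subset by auto
    then show "(\<Prod>a\<in>A - S. y * const3 (q a * q a) + x) * leib S (\<lambda>a b. z * const3 (N a b)) = (\<Sum>J\<in>Pow (A - S).
      (y ^ card J * const3 (\<Prod>a\<in>J. q a * q a) * x ^ (n - card S - card J)) * (z ^ card S * const3 (leib S N)))"
      unfolding prodJ[OF S] by (simp only: sum_distrib_right leib_scale const3_leib)
  qed
  also have "\<dots> = (\<Sum>(S, J)\<in>T.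
      (y ^ card J * const3 (\<Prod>a\<in>J. q a * q a) * x ^ (n - card S - card J)) * (z ^ card S * const3 (leib S N)))"
    unfolding T_def using A by (intro sum.Sigma) auto
  finally have leib: "leib A B = \<dots>" .
  have "const3 ((s * s) ^ n) * leib A B = (\<Sum>(S, J)\<in>T. Poly_Mapping.single (n - card S - card J, card J, card S)
      ((s * s) ^ n * ((\<Prod>a\<in>J. q a * q a) * leib S N)))"
    unfolding leib sum_distrib_left
  proof (intro sum.cong refl, clarify)
    fix S J
    show "const3 ((s * s) ^ n) * ((y ^ card J * const3 (\<Prod>a\<in>J. q a * q a) * x ^ (n - card S - card J)) * (z ^ card S * const3 (leib S N)))
      = Poly_Mapping.single (n - card S - card J, card J, card S) ((s * s) ^ n * ((\<Prod>a\<in>J. q a * q a) * leib S N))"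
      unfolding mono[symmetric] const3_mult by (simp only: mult_ac)
  qed
  moreover have "Determinant.det (pencil (gram n (diag (\<lambda>a. s))) (gram n (diag (\<lambda>a. s * q a))) (gram n (\<lambda>a b. s * R a b)))
      = const3 ((s * s) ^ n) * leib A B"
    unfolding pencil det_eq_leib leib_scale[OF finite_atLeastLessThan] const3_power by (simp add: A_def)
  ultimately show ?thesis by (simp only: T_def A_def N_def[abs_def])
qed

lemma sum_single_group:
  fixes v :: "'t \<Rightarrow> puiseux"
  assumes "finite T" "ty ` T \<subseteq> Delta n"
  shows "(\<Sum>d\<in>Delta n. Poly_Mapping.single d (\<Sum>t | t \<in> T \<and> ty t = d. v t)) = (\<Sum>t\<in>T. Poly_Mapping.single (ty t) (v t))"
proof -
  have single_sum: "Poly_Mapping.single d (\<Sum>t\<in>U. v t) = (\<Sum>t\<in>U. Poly_Mapping.single d (v t))" for d :: triple and U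
    by (induction U rule: infinite_finite_induct) (auto simp: single_add)
  have "(\<Sum>d\<in>Delta n. Poly_Mapping.single d (\<Sum>t | t \<in> T \<and> ty t = d. v t))
    = (\<Sum>d\<in>Delta n. \<Sum>t | t \<in> T \<and> ty t = d. Poly_Mapping.single (ty t) (v t))"
    unfolding single_sum by (intro sum.cong refl) auto
  also have "\<dots> = (\<Sum>t\<in>T. Poly_Mapping.single (ty t) (v t))"
    by (rule sum.group[OF assms(1) finite_Delta assms(2)])
  finally show ?thesis .
qed

lemma lookup_sum_single:
  "Poly_Mapping.lookup (\<Sum>d\<in>Delta n. Poly_Mapping.single d (F d :: puiseux)) d' = (if d' \<in> Delta n then F d' else 0)"
  by (simp add: lookup_sum lookup_single when_def finite_Delta)

section \<open>Hives as network weights\<close>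

text \<open>
  The increments of \<open>g\<close> along two directions of edges of the triangle: in the layer \<open>k = c\<close> from \<open>(r - c, n - r, c)\<close>,
  where one unit passes from \<open>j\<close> to \<open>i\<close>, and from the point so reached into the next layer, where one unit passes from \<open>i\<close>
  to \<open>k\<close>.
\<close>

definition edge_yx :: "(triple \<Rightarrow> rat) \<Rightarrow> nat \<Rightarrow> nat \<Rightarrow> nat \<Rightarrow> rat" where
  "edge_yx g n c r = g (r - c + 1, n - 1 - r, c) - g (r - c, n - r, c)"

definition edge_xz :: "(triple \<Rightarrow> rat) \<Rightarrow> nat \<Rightarrow> nat \<Rightarrow> nat \<Rightarrow> rat" where
  "edge_xz g n c r = g (r - c, n - 1 - r, c + 1) - g (r - c + 1, n - 1 - r, c)"

text \<open>
  Each inequality compares parallel edges of a rhombus of the triangle. In the identity both sides of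
  \<open>e c (r + 1) + \<alpha> c (r + 1) = e c r + \<alpha> (c + 1) (r + 1)\<close> are the increment from \<open>(r + 1 - c, n - 1 - r, c)\<close> to
  \<open>(r + 1 - c, n - 2 - r, c + 1)\<close>, along two different ways.
\<close>

lemma hive_path_weights:
  fixes g :: "triple \<Rightarrow> rat"
  assumes "hive n g"
  shows "path_weights n (edge_yx g n) (edge_xz g n)"
proof -
  have hive: "(k \<ge> 2 \<longrightarrow> g (i+1, j, k-1) + g (i, j+1, k-1) \<ge> g (i, j, k) + g (i+1, j+1, k-2)) \<and>
     (j \<ge> 2 \<longrightarrow> g (i+1, j-1, k) + g (i, j-1, k+1) \<ge> g (i, j, k) + g (i+1, j-2, k+1)) \<and>
     (i \<ge> 2 \<longrightarrow> g (i-1, j+1, k) + g (i-1, j, k+1) \<ge> g (i, j, k) + g (i-2, j+1, k+1))"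
    if "i + j + k = n" for i j k
    using assms that unfolding hive_def Delta_def by blast
  have norm: "\<exists>d m. r = c + d \<and> n = c + d + m + 2" if "c \<le> r" "Suc r < n" for c r
    using that by (intro exI[of _ "r - c"] exI[of _ "n - r - 2"]) auto
  show ?thesis
  proof (unfold_locales, unfold edge_yx_def edge_xz_def)
    fix c r assume cr: "c \<le> r" "Suc r < n"
    then obtain d m where r: "r = c + d" and n: "n = c + d + m + 2" using norm by blast
    show "g (Suc r - c + 1, n - 1 - Suc r, c) - g (Suc r - c, n - Suc r, c)
      \<le> g (Suc r - Suc c + 1, n - 1 - Suc r, Suc c) - g (Suc r - Suc c, n - Suc r, Suc c)"
      using hive[of "d + 2" m c] by (simp add: r n Suc_diff_le numeral_2_eq_2)
    show "g (Suc r - Suc c + 1, n - 1 - Suc r, Suc c) - g (Suc r - Suc c, n - Suc r, Suc c)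
      \<le> g (r - c + 1, n - 1 - r, c) - g (r - c, n - r, c)"
      using hive[of d "m + 2" c] by (simp add: r n Suc_diff_le numeral_2_eq_2)
    show "g (Suc r - c, n - 1 - Suc r, c + 1) - g (Suc r - c + 1, n - 1 - Suc r, c) -
        (g (r - c, n - 1 - r, c + 1) - g (r - c + 1, n - 1 - r, c))
      = g (Suc r - Suc c + 1, n - 1 - Suc r, Suc c) - g (Suc r - Suc c, n - Suc r, Suc c) -
        (g (Suc r - c + 1, n - 1 - Suc r, c) - g (Suc r - c, n - Suc r, c))"
      by (simp add: r n Suc_diff_le numeral_2_eq_2)
    show "g (Suc r - Suc c, n - 1 - Suc r, Suc c + 1) - g (Suc r - Suc c + 1, n - 1 - Suc r, Suc c)
      \<le> g (r - c, n - 1 - r, c + 1) - g (r - c + 1, n - 1 - r, c)"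
      using hive[of d m "c + 2"] by (simp add: r n Suc_diff_le numeral_2_eq_2)
  qed
qed

text \<open>
  Both sides measure the way from \<open>(n, 0, 0)\<close> to \<open>(i, j, k)\<close>: first along the edge \<open>k = 0\<close> to
  \<open>(i + k, j, 0)\<close>, and then with \<open>j\<close> fixed through the layers.
\<close>

lemma hive_telescope:
  fixes g :: "triple \<Rightarrow> rat"
  assumes "i + j + k = n"
  shows "(\<Sum>b<k. edge_xz g n b (i + k - 1)) - (\<Sum>r\<in>{i + k..<n}. edge_yx g n 0 r) = g (i, j, k) - g (n, 0, 0)"
proof -
  have "(\<Sum>b<k. edge_xz g n b (i + k - 1)) = (\<Sum>b<k. g (i + k - Suc b, j, Suc b) - g (i + k - b, j, b))"
  proof (intro sum.cong refl)
    fix b assume "b \<in> {..<k}"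
    then have "i + k - 1 - b + 1 = i + k - b" "n - 1 - (i + k - 1) = j" "i + k - 1 - b = i + k - Suc b"
      using assms by auto
    then show "edge_xz g n b (i + k - 1) = g (i + k - Suc b, j, Suc b) - g (i + k - b, j, b)"
      by (simp add: edge_xz_def)
  qed
  also have "\<dots> = g (i, j, k) - g (i + k, j, 0)"
    by (subst sum_lessThan_telescope[of "\<lambda>b. g (i + k - b, j, b)"]) simp
  finally have xz: "(\<Sum>b<k. edge_xz g n b (i + k - 1)) = g (i, j, k) - g (i + k, j, 0)" .
  have "(\<Sum>r\<in>{i + k..<n}. edge_yx g n 0 r) = (\<Sum>r\<in>{i + k..<n}. g (Suc r, n - Suc r, 0) - g (r, n - r, 0))"
    by (simp add: edge_yx_def)
  also have "\<dots> = g (n, n - n, 0) - g (i + k, n - (i + k), 0)"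
    using assms sum_Suc_diff'[of "i + k" n "\<lambda>r. g (r, n - r, 0)"] by linarith
  also have "\<dots> = g (n, 0, 0) - g (i + k, j, 0)"
    using assms by auto
  finally show ?thesis unfolding xz by simp
qed

section \<open>Realisation of a hive\<close>

theorem theorem14:
  fixes n :: nat and h :: "nat \<times> nat \<times> nat \<Rightarrow> rat"
  assumes "n \<ge> 1" and "hive n h"
  shows "\<exists>F :: nat \<times> nat \<times> nat \<Rightarrow> puiseux.
           (\<forall>d \<in> Delta n. F d \<in> pos_puiseux \<and> lead_exp (F d) = h d) \<and>
           (\<Sum>d \<in> Delta n. Poly_Mapping.single d (F d)) \<in> \<H> n"
proof -
  \<comment> \<open>Exponents of the coefficients are twice those of the minors.\<close>
  define g where "g d = h d / 2" for d
  have hg: "h d = g d + g d" for d by (simp add: g_def)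
  have "hive n g"
    using assms(2) unfolding hive_def g_def by (fastforce simp flip: add_divide_distrib)
  define \<alpha> e where "\<alpha> = edge_yx g n" and "e = edge_xz g n"
  interpret path_weights n \<alpha> e
    unfolding \<alpha>_def e_def by (rule hive_path_weights[OF \<open>hive n g\<close>])
  have telescope: "(\<Sum>b<k. e b (i + k - 1)) - (\<Sum>r\<in>{i + k..<n}. \<alpha> 0 r) = g (i, j, k) - g (n, 0, 0)"
    if "i + j + k = n" for i j k
    unfolding \<alpha>_def e_def by (rule hive_telescope[OF that])
  define R where "R = net 0"
  \<comment> \<open>Normalises the coefficient of \<open>x\<^sup>n\<close>, which is \<open>s\<close> to the power \<open>2 n\<close>.\<close>
  define s where "s = tpow (g (n, 0, 0) / of_nat n)"
  define q where "q a = tpow (- \<alpha> 0 a)" for a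
  define N where "N a b = (\<Sum>\<kappa><n. R a \<kappa> * R b \<kappa>)" for a b
  define T where "T = Sigma (Pow {0..<n}) (\<lambda>S. Pow ({0..<n} - S))"
  define ty where "ty = (\<lambda>(S :: nat set, J :: nat set). (n - card S - card J, card J, card S))"
  define v where "v = (\<lambda>(S, J). (s * s) ^ n * ((\<Prod>a\<in>J. q a * q a) * leib S N))"
  define F where "F d = (\<Sum>t | t \<in> T \<and> ty t = d. v t)" for d
  have T: "finite T" by (auto simp: T_def)
  have TD: "S \<subseteq> {0..<n}" "J \<subseteq> {0..<n} - S" "finite S" "finite J" "card S + card J \<le> n"
    if "(S, J) \<in> T" for S J
  proof -
    show SJ: "S \<subseteq> {0..<n}" "J \<subseteq> {0..<n} - S" "finite S" "finite J"
      using that by (auto simp: T_def intro: finite_subset)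
    have "card S + card J = card (S \<union> J)" using SJ by (subst card_Un_disjoint) auto
    also have "\<dots> \<le> n" using SJ card_mono[of "{0..<n}" "S \<union> J"] by auto
    finally show "card S + card J \<le> n" .
  qed
  have R_real: "R a b \<in> real_puiseux" for a b by (simp add: R_def net_real)

  \<comment> \<open>The exponent of a minor whose square, times the monomial from \<open>J\<close> and \<open>s\<close>, has exponent \<open>h (i, j, k)\<close>.\<close>
  define m where "m i j k J = g (i, j, k) - g (n, 0, 0) + (\<Sum>a\<in>J. \<alpha> 0 a)" for i j k J
  have s_power: "(s * s) ^ n = tpow (h (n, 0, 0))"
    using assms(1) by (simp add: s_def tpow_mult tpow_power hg flip: add_divide_distrib)
  have v_eq: "v (S, J) = tpow (h (i, j, k) - (m i j k J + m i j k J)) * leib S N" if "finite J" for S J i j k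
  proof -
    have "(\<Prod>a\<in>J. q a * q a) = tpow (\<Sum>a\<in>J. - \<alpha> 0 a + - \<alpha> 0 a)"
      unfolding q_def tpow_mult using that by (rule tpow_sum)
    also have "(\<Sum>a\<in>J. - \<alpha> 0 a + - \<alpha> 0 a) = - (\<Sum>a\<in>J. \<alpha> 0 a) - (\<Sum>a\<in>J. \<alpha> 0 a)"
      by (simp add: sum.distrib sum_negf sum_distrib_left)
    finally show ?thesis
      by (simp add: v_def s_power tpow_mult m_def hg flip: mult.assoc)
  qed
  have minors: "deg_le (leib S (\<lambda>a b. R a (f b))) (m i j k J)"
    if "(S, J) \<in> T" "ty (S, J) = (i, j, k)" for S J i j k f
  proof -
    note SJ = TD[OF that(1)]
    then have ijk: "i + j + k = n" "card S = k" "card J = j"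
      using that(2) by (auto simp: ty_def)
    have "best 0 S - (\<Sum>r\<in>J. \<alpha> 0 r) \<le> g (i, j, k) - g (n, 0, 0)"
      unfolding telescope[OF ijk(1), symmetric] using SJ ijk by (intro best_le_sorted) auto
    then have "best 0 S \<le> m i j k J" by (simp add: m_def)
    moreover have "deg_le (leib S (\<lambda>a b. R a (f b))) (best 0 S)"
      unfolding R_def using SJ by (intro net_minor_deg_le) auto
    ultimately show ?thesis by (rule deg_le_mono[rotated])
  qed
  have v_nonneg: "nonneg_top (v t) (h d)" if "t \<in> T" "ty t = d" for t d
  proof -
    obtain S J i j k where t: "t = (S, J)" and d: "d = (i, j, k)" by (metis surj_pair)
    have fin: "finite S" "finite J"
      using that(1) by (auto simp: t T_def intro: finite_subset)
    have "nonneg_top (leib S N) (m i j k J + m i j k J)"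
      unfolding N_def using that by (intro minor_gram_top(1) fin R_real minors) (auto simp: t d)
    from nonneg_top_mult[OF nonneg_top_tpow this]
    show ?thesis unfolding t d v_eq[OF fin(2), of S i j k] by (metis diff_add_cancel)
  qed

  have F_pos: "F d \<in> pos_puiseux \<and> lead_exp (F d) = h d" if d: "d \<in> Delta n" for d
  proof -
    obtain i j k where ijk: "d = (i, j, k)" "i + j + k = n" using d by (auto simp: Delta_def)
    \<comment> \<open>The summand of the sorted partition attains the exponent.\<close>
    define S where "S = {i..<i + k}"
    define J where "J = {i + k..<n}"
    have SJ: "(S, J) \<in> T" "ty (S, J) = d" "finite S" "finite J"
      using ijk by (auto simp: S_def J_def T_def ty_def)
    have "(\<Sum>b<k. e (0 + b) (i + k - 1)) = m i j k J"
      using telescope[OF ijk(2)] by (simp add: m_def J_def)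
    then have exact: "leib S (\<lambda>a b. R a (0 + (b - i))) = tpow (m i j k J)"
      unfolding R_def S_def using ijk by (subst net_interval_minor) auto
    have cols: "(\<lambda>b. 0 + (b - i)) \<in> S \<rightarrow> {..<n}" using ijk by (auto simp: S_def)
    have le: "deg_le (leib S (\<lambda>a b. R a (f b))) (m i j k J)" for f
      using SJ ijk by (intro minors) auto
    have top: "nonneg_top (leib S N) (m i j k J + m i j k J)"
      unfolding N_def by (rule minor_gram_top(1)[OF SJ(3) R_real le])
    have pos: "Re (pcoeff (leib S N) (m i j k J + m i j k J)) > 0"
      unfolding N_def by (rule minor_gram_top(2)[OF SJ(3) R_real le cols exact])
    have "pcoeff (v (S, J)) (h d) = pcoeff (leib S N) (m i j k J + m i j k J)"
      using pcoeff_mult_top[OF deg_le_tpow, of "leib S N" "m i j k J + m i j k J" "h d - (m i j k J + m i j k J)"] top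
      unfolding v_eq[OF SJ(4), of S i j k] ijk(1) by (simp add: nonneg_top_def tpow.rep_eq)
    with pos have v_pos: "Re (pcoeff (v (S, J)) (h d)) > 0" by simp
    let ?U = "{t. t \<in> T \<and> ty t = d}"
    have "F d = v (S, J) + (\<Sum>t\<in>?U - {(S, J)}. v t)"
      unfolding F_def using T SJ by (intro sum.remove) auto
    moreover have "nonneg_top (\<Sum>t\<in>?U - {(S, J)}. v t) (h d)"
      by (intro nonneg_top_sum v_nonneg) auto
    ultimately have "Re (pcoeff (F d) (h d)) > 0"
      using v_pos by (simp add: pcoeff_add nonneg_top_def)
    moreover have "nonneg_top (F d) (h d)"
      unfolding F_def by (intro nonneg_top_sum v_nonneg) auto
    ultimately show ?thesis
      using pos_puiseuxI[of "F d" "h d"] by (simp add: nonneg_top_def)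
  qed

  have s0: "s \<noteq> 0" "s \<in> real_puiseux" and q0: "q a \<noteq> 0" "q a \<in> real_puiseux" for a
    by (simp_all add: s_def q_def)
  have X: "pos_def_hermitian n (gram n (diag (\<lambda>a. s)))"
    using s0 by (intro pos_def_gram) (auto simp: leib_diag diag_def)
  have Y: "pos_def_hermitian n (gram n (diag (\<lambda>a. s * q a)))"
    using s0 q0 by (intro pos_def_gram) (auto simp: leib_diag diag_def real_mult)
  have Z: "pos_def_hermitian n (gram n (\<lambda>a b. s * R a b))"
  proof (rule pos_def_gram)
    show "s * R a b \<in> real_puiseux" for a b by (intro real_mult s0 R_real)
    have "leib {0..<n} R \<noteq> 0"
      using net_interval_minor[of 0 n 0] by (simp add: R_def)
    then show "leib {0..<n} (\<lambda>a b. s * R a b) \<noteq> 0" using s0 by (simp add: leib_scale)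
  qed
  have ty_Delta: "ty ` T \<subseteq> Delta n"
  proof clarify
    fix S J i j k assume "(S, J) \<in> T" "(i, j, k) = ty (S, J)"
    then show "(i, j, k) \<in> Delta n"
      using TD(5)[of S J] by (auto simp: ty_def Delta_def)
  qed
  have det: "(\<Sum>d\<in>Delta n. Poly_Mapping.single d (F d)) = Determinant.det
      (pencil (gram n (diag (\<lambda>a. s))) (gram n (diag (\<lambda>a. s * q a))) (gram n (\<lambda>a b. s * R a b)))"
    unfolding F_def sum_single_group[OF T ty_Delta] det_pencil_expand
    by (simp only: T_def ty_def v_def N_def[abs_def] split_def)
  have "(\<Sum>d\<in>Delta n. Poly_Mapping.single d (F d)) \<in> \<H> n"
    unfolding \<H>_def
  proof (intro CollectI conjI allI)
    show "Poly_Mapping.keys (\<Sum>d\<in>Delta n. Poly_Mapping.single d (F d)) \<subseteq> Delta n"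
      by (auto simp: in_keys_iff lookup_sum_single split: if_splits)
    show "Poly_Mapping.lookup (\<Sum>d\<in>Delta n. Poly_Mapping.single d (F d)) d \<in> real_puiseux" for d
      using F_pos by (auto simp: lookup_sum_single pos_puiseux_def)
    show "\<exists>X Y Z. pos_def_hermitian n X \<and> pos_def_hermitian n Y \<and> pos_def_hermitian n Z \<and>
        (\<Sum>d\<in>Delta n. Poly_Mapping.single d (F d)) = Determinant.det (pencil X Y Z)"
      using X Y Z det by blast
  qed
  with F_pos show ?thesis by blast
qed

end
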